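(* For a regular Hausdorff space $X$ the following are equivalent: (1) $X$ has a point-countable base; (2) $\mathcal{F}_2(X)$ is a Fréchet–Urysohn space with a point-countable $k$-network; (3) $\mathcal{K}(X)$ is a Fréchet–Urysohn space with a point-countable $k$-network; (4) $\mathcal{K}(X)$ has a point-countable weak base; (5) $\mathcal{K}(X)$ has a compact-countable weak base; (6) $\mathcal{K}(X)$ has a point-countable base.
   Context: $\mathcal{K}(X)$ is the set of nonempty compact subsets of $X$ with the Vietoris topology (base: $\langle U_1,\dots,U_k\rangle=\{K: K\subset\bigcup_i U_i,\ K\cap U_j\neq\emptyset\ \forall j\}$, $U_i$ open in $X$), and $\mathcal{F}_2(X)$ is its subspace of subsets of cardinality at most 2. A $k$-network is a family $\mathcal{P}$ such that for every compact $K$ and open $U\supset K$ some finite $\mathcal{P}'\subset\mathcal{P}$ has $K\subset\bigcup\mathcal{P}'\subset U$. A weak base for $Y$ is a cover $\mathcal{P}=\bigcup_{y\in Y}\mathcal{P}_y$ such that: for $U,V\in\mathcal{P}_y$ there is $W\in\mathcal{P}_y$ with $W\subset U\cap V$; each member of $\mathcal{P}_y$ contains $y$, and for each open $U\ni y$ some $P\in\mathcal{P}_y$ has $P\subset U$; and a set $G\subset Y$ is open whenever for each $y\in G$ some $P\in\mathcal{P}_y$ satisfies $P\subset G$. A family is point-countable (resp. compact-countable) if each point (resp. each compact set) meets only countably many members. *)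

theory Defs
  imports "HOL-Analysis.Analysis"
begin

definition vietoris_basic :: "'a topology \<Rightarrow> 'a set set \<Rightarrow> 'a set set" where
  "vietoris_basic X Us =
     {K. compactin X K \<and> K \<noteq> {} \<and> K \<subseteq> \<Union>Us \<and> (\<forall>U\<in>Us. K \<inter> U \<noteq> {})}"

definition vietoris :: "'a topology \<Rightarrow> 'a set topology" where
  "vietoris X = topology_generated_by
     {vietoris_basic X Us | Us. finite Us \<and> Us \<noteq> {} \<and> (\<forall>U\<in>Us. openin X U)}"

definition F2 :: "'a topology \<Rightarrow> 'a set topology" where
  "F2 X = subtopology (vietoris X) {K. finite K \<and> card K \<le> 2}"

definition is_base :: "'a topology \<Rightarrow> 'a set set \<Rightarrow> bool" where
  "is_base X \<B> \<longleftrightarrow> (\<forall>B\<in>\<B>. openin X B) \<and>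
     (\<forall>U. openin X U \<longrightarrow> (\<exists>\<C>\<subseteq>\<B>. \<Union>\<C> = U))"

definition point_countable :: "'a topology \<Rightarrow> 'a set set \<Rightarrow> bool" where
  "point_countable X \<P> \<longleftrightarrow> (\<forall>x\<in>topspace X. countable {P\<in>\<P>. x \<in> P})"

definition compact_countable :: "'a topology \<Rightarrow> 'a set set \<Rightarrow> bool" where
  "compact_countable X \<P> \<longleftrightarrow> (\<forall>K. compactin X K \<longrightarrow> countable {P\<in>\<P>. P \<inter> K \<noteq> {}})"

definition k_network :: "'a topology \<Rightarrow> 'a set set \<Rightarrow> bool" where
  "k_network X \<P> \<longleftrightarrow> (\<forall>P\<in>\<P>. P \<subseteq> topspace X) \<and>
     (\<forall>K U. compactin X K \<and> openin X U \<and> K \<subseteq> U \<longrightarrow>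
        (\<exists>\<P>'. finite \<P>' \<and> \<P>' \<subseteq> \<P> \<and> K \<subseteq> \<Union>\<P>' \<and> \<Union>\<P>' \<subseteq> U))"

definition Frechet_Urysohn :: "'a topology \<Rightarrow> bool" where
  "Frechet_Urysohn X \<longleftrightarrow> (\<forall>A x. A \<subseteq> topspace X \<and> x \<in> X closure_of A \<longrightarrow>
     (\<exists>f. range f \<subseteq> A \<and> limitin X f x sequentially))"

definition weak_base :: "'a topology \<Rightarrow> ('a \<Rightarrow> 'a set set) \<Rightarrow> bool" where
  "weak_base X \<P> \<longleftrightarrow>
     (\<forall>y\<in>topspace X. \<forall>P\<in>\<P> y. P \<subseteq> topspace X \<and> y \<in> P) \<and>
     (\<forall>y\<in>topspace X. \<forall>U\<in>\<P> y. \<forall>V\<in>\<P> y. \<exists>W\<in>\<P> y. W \<subseteq> U \<inter> V) \<and>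
     (\<forall>y\<in>topspace X. \<forall>U. openin X U \<and> y \<in> U \<longrightarrow> (\<exists>P\<in>\<P> y. P \<subseteq> U)) \<and>
     (\<forall>G. G \<subseteq> topspace X \<and> (\<forall>y\<in>G. \<exists>P\<in>\<P> y. P \<subseteq> G) \<longrightarrow> openin X G)"

definition weak_base_family :: "'a topology \<Rightarrow> ('a \<Rightarrow> 'a set set) \<Rightarrow> 'a set set" where
  "weak_base_family X \<P> = (\<Union>y\<in>topspace X. \<P> y)"

end

theory Submission
  imports Defs
begin

text \<open>The two implications with content are (2) to (1) and (4) to (1).

  (2) to (1): in \<open>F2 X\<close> the pairs \<open>{z n, a}\<close> with \<open>a \<in> A n\<close> show that \<open>X\<close> is strongly Frechet. With a
  point-countable k-network \<open>\<P>\<close>, every neighbourhood of a point then contains the union of a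
  finite subfamily of \<open>\<P>\<close> that is itself a neighbourhood of the point. Mishchenko's lemma shows
  that each set has only countably many minimal finite interior covers by members of \<open>\<P>\<close>, and
  from these one builds a point-countable base as Burke and Michael did.

  (4) to (1): the singletons inherit a point-countable weak base from the hyperspace, and
  it suffices that its members are neighbourhoods. If one of them is not, \<open>X\<close> contains a
  convergent sequence \<open>T\<close> each of whose points is the limit of a sequence outside it. Adding single
  points of these sequences to \<open>T\<close> gives a sequential fan in the hyperspace with vertex \<open>T\<close>,
  which a countable weak base at \<open>T\<close> excludes.

  In (1) to (6) and (6) to (5), Mishchenko's lemma is used again: a point-countable base of a T1
  space is compact-countable.\<close>

section \<open>Point-countable covers and bases\<close>

lemma is_baseI:
  assumes "\<And>B. B \<in> \<B> \<Longrightarrow> openin X B"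
    and local_base: "\<And>U x. openin X U \<Longrightarrow> x \<in> U \<Longrightarrow> \<exists>B\<in>\<B>. x \<in> B \<and> B \<subseteq> U"
  shows "is_base X \<B>"
proof -
  have "\<Union>{B\<in>\<B>. B \<subseteq> U} = U" if "openin X U" for U
    using local_base[OF that] by blast
  then have "\<exists>\<C>\<subseteq>\<B>. \<Union>\<C> = U" if "openin X U" for U
    using that by (intro exI[of _ "{B\<in>\<B>. B \<subseteq> U}"]) auto
  then show ?thesis
    using assms(1) by (auto simp: is_base_def)
qed

lemma is_base_openin: "is_base X \<B> \<Longrightarrow> B \<in> \<B> \<Longrightarrow> openin X B"
  by (auto simp: is_base_def)

lemma is_baseE:
  assumes "is_base X \<B>" "openin X U" "x \<in> U"
  obtains B where "B \<in> \<B>" "x \<in> B" "B \<subseteq> U"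
  using assms unfolding is_base_def by blast

text \<open>The condition \<open>C\<close> stays abstract because two instances occur: ordinary
  covers \<open>K \<subseteq> \<Union>F\<close> and interior covers
  \<open>A \<subseteq> X interior_of \<Union>F\<close>.\<close>

definition minimal_finite :: "('a set set \<Rightarrow> bool) \<Rightarrow> 'a set set \<Rightarrow> 'a set set \<Rightarrow> bool" where
  "minimal_finite C \<P> F \<longleftrightarrow> finite F \<and> F \<subseteq> \<P> \<and> C F \<and> (\<forall>E. E \<subset> F \<longrightarrow> \<not> C E)"

lemma compactin_base_subcover:
  assumes "compactin X K" "is_base X \<B>" "\<C> \<subseteq> \<B>" "K \<subseteq> \<Union>\<C>"
  obtains F where "finite F" "F \<subseteq> \<C>" "K \<subseteq> \<Union>F"
  using compactinD[of X K \<C>] is_base_openin[OF assms(2)] assms by (meson subsetD)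

lemma minimal_finite_subset:
  assumes "finite F" "F \<subseteq> \<P>" "C F"
  obtains E where "E \<subseteq> F" "minimal_finite C \<P> E"
proof -
  have "\<exists>E\<subseteq>F. minimal_finite C \<P> E"
    using assms
  proof (induction F rule: finite_psubset_induct)
    case (psubset F)
    show ?case
    proof (cases "\<exists>E. E \<subset> F \<and> C E")
      case True
      then obtain E where "E \<subset> F" "C E" by blast
      then show ?thesis
        using psubset.IH[of E] psubset.prems by (meson psubset_imp_subset subset_trans)
    next
      case False
      then show ?thesis
        using psubset by (auto simp: minimal_finite_def)
    qed
  qed
  then show ?thesis using that by blast
qed

text \<open>Mishchenko's argument: a minimal family \<open>F\<close> is reached from \<open>{}\<close> by adding one
  member at a time, and at each step only countably many candidates need to be considered.\<close>

lemma countable_minimal_finite: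
  assumes step: "\<And>R. finite R \<Longrightarrow> R \<subseteq> \<P> \<Longrightarrow> \<not> C R \<Longrightarrow>
    \<exists>S. countable S \<and> (\<forall>F. finite F \<longrightarrow> F \<subseteq> \<P> \<longrightarrow> C F \<longrightarrow> R \<subseteq> F \<longrightarrow> (F - R) \<inter> S \<noteq> {})"
  shows "countable {F. minimal_finite C \<P> F}"
proof -
  \<comment> \<open>The side conditions on \<open>R\<close> sit inside \<open>good\<close>, so that
    a set \<open>S R\<close> can be chosen for every \<open>R\<close> whatsoever.\<close>
  define good where "good R S \<longleftrightarrow> countable S \<and>
    (finite R \<longrightarrow> R \<subseteq> \<P> \<longrightarrow> \<not> C R \<longrightarrow>
      (\<forall>F. finite F \<longrightarrow> F \<subseteq> \<P> \<longrightarrow> C F \<longrightarrow> R \<subseteq> F \<longrightarrow> (F - R) \<inter> S \<noteq> {}))" for R S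
  have "\<exists>S. good R S" for R
    using step[of R] unfolding good_def by (metis countable_empty)
  then obtain S where S: "\<And>R. good R (S R)" by metis
  \<comment> \<open>\<open>T n\<close> holds the families, of at most \<open>n\<close> members, that
    arise from \<open>{}\<close> by \<open>n\<close> insertions, each drawn from the countable set
    attached to the current family.\<close>
  define T where "T n = ((\<lambda>\<R>. \<Union>R\<in>\<R>. (\<lambda>P. insert P R) ` S R) ^^ n) {{}}" for n
  have T_Suc: "T (Suc n) = (\<Union>R\<in>T n. (\<lambda>P. insert P R) ` S R)" for n
    by (simp add: T_def)
  have T: "countable (T n)" for n
  proof (induction n)
    case (Suc n)
    then show ?case
      unfolding T_Suc using S by (auto simp: good_def)
  qed (simp add: T_def)
  have "F \<in> T (card F)" if F: "minimal_finite C \<P> F" for F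
  proof -
    \<comment> \<open>As long as \<open>R\<close> is a proper subfamily of \<open>F\<close>,
      minimality gives \<open>\<not> C R\<close>, so \<open>S R\<close> offers a member of
      \<open>F - R\<close> to insert.\<close>
    have "\<exists>R\<in>T k. R \<subseteq> F \<and> card R = k" if "k \<le> card F" for k
      using that
    proof (induction k)
      case (Suc k)
      then obtain R where R: "R \<in> T k" "R \<subseteq> F" "card R = k" by auto
      with Suc.prems have "R \<subset> F" by auto
      with F have "\<not> C R" "finite R" "R \<subseteq> \<P>"
        by (auto simp: minimal_finite_def intro: finite_subset)
      with S[of R] F R(2) have "(F - R) \<inter> S R \<noteq> {}"
        unfolding good_def minimal_finite_def by blast
      then obtain P where "P \<in> F" "P \<notin> R" "P \<in> S R" by blast
      then show ?case
        using R \<open>finite R\<close> by (intro bexI[of _ "insert P R"]) (auto simp: T_Suc)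
    qed (simp add: T_def)
    from this[of "card F"] F show ?thesis
      by (metis card_subset_eq minimal_finite_def order_refl)
  qed
  then have "{F. minimal_finite C \<P> F} \<subseteq> (\<Union>n. T n)" by blast
  with T show ?thesis by (meson countableI_type countable_UN countable_subset)
qed

text \<open>Let \<open>B\<close> meet \<open>K\<close> in \<open>x\<close>. By T1 the compact set
  \<open>K - B\<close> is covered by finitely many members that omit \<open>x\<close>. Together with
  \<open>B\<close> they cover \<open>K\<close>, and every minimal subcover must keep
  \<open>B\<close> in order to cover \<open>x\<close>. Thus each member meeting \<open>K\<close>
  lies in one of the countably many minimal finite covers of \<open>K\<close>.\<close>

lemma point_countable_imp_compact_countable_base:
  assumes T1: "t1_space X" and base: "is_base X \<B>" and pc: "point_countable X \<B>"
  shows "compact_countable X \<B>"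
  unfolding compact_countable_def
proof (intro allI impI)
  fix K assume K: "compactin X K"
  then have KX: "K \<subseteq> topspace X" by (rule compactin_subset_topspace)
  define M where "M = minimal_finite (\<lambda>F. K \<subseteq> \<Union>F) \<B>"
  have ctb: "countable (Collect M)"
    unfolding M_def
  proof (rule countable_minimal_finite)
    fix R :: "'a set set" assume "\<not> K \<subseteq> \<Union>R"
    \<comment> \<open>A cover extending \<open>R\<close> must add a member through the uncovered
      point \<open>d\<close>, and only countably many members contain \<open>d\<close>.\<close>
    then obtain d where d: "d \<in> K" "d \<notin> \<Union>R" by blast
    show "\<exists>S. countable S \<and> (\<forall>F. finite F \<longrightarrow> F \<subseteq> \<B> \<longrightarrow> K \<subseteq> \<Union>F \<longrightarrow>
        R \<subseteq> F \<longrightarrow> (F - R) \<inter> S \<noteq> {})"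
    proof (intro exI conjI allI impI)
      show "countable {P\<in>\<B>. d \<in> P}" using pc KX d by (auto simp: point_countable_def)
      show "(F - R) \<inter> {P\<in>\<B>. d \<in> P} \<noteq> {}" if "F \<subseteq> \<B>" "K \<subseteq> \<Union>F" for F
        using that d by blast
    qed
  qed
  have "\<exists>F. M F \<and> B \<in> F" if B: "B \<in> \<B>" "B \<inter> K \<noteq> {}" for B
  proof -
    obtain x where x: "x \<in> B" "x \<in> K" using B by blast
    have opB: "openin X B" using base B(1) by (rule is_base_openin)
    have cpt: "compactin X (K - B)"
    proof -
      have "closedin X (topspace X - B)" using opB by auto
      moreover have "K - B = K \<inter> (topspace X - B)" using KX by blast
      ultimately show ?thesis using K compact_Int_closedin by metis
    qed
    have cov: "K - B \<subseteq> \<Union>{C\<in>\<B>. x \<notin> C}"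
    proof
      fix y assume y: "y \<in> K - B"
      have "openin X (topspace X - {x})"
        using T1 x KX by (simp add: closedin_t1_singleton openin_diff subsetD)
      moreover have "y \<in> topspace X - {x}" using y x KX by blast
      ultimately obtain C where "C \<in> \<B>" "y \<in> C" "C \<subseteq> topspace X - {x}"
        using base by (rule_tac is_baseE)
      then show "y \<in> \<Union>{C\<in>\<B>. x \<notin> C}" by blast
    qed
    obtain G where G: "finite G" "G \<subseteq> {C\<in>\<B>. x \<notin> C}" "K - B \<subseteq> \<Union>G"
      using cpt base _ cov by (rule compactin_base_subcover) auto
    then have "finite (insert B G)" by simp
    moreover have "insert B G \<subseteq> \<B>" using B G(2) by blast
    moreover have "K \<subseteq> \<Union>(insert B G)" using G(3) by blast
    ultimately obtain E where E: "E \<subseteq> insert B G" "M E"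
      unfolding M_def by (rule minimal_finite_subset[where C = "\<lambda>F. K \<subseteq> \<Union>F"])
    then have "K \<subseteq> \<Union>E" by (simp add: M_def minimal_finite_def)
    with x G(2) E(1) have "B \<in> E" by blast
    with E show ?thesis by blast
  qed
  then have "{B\<in>\<B>. B \<inter> K \<noteq> {}} \<subseteq> (\<Union>F\<in>Collect M. F)" by blast
  moreover have "countable (\<Union>F\<in>Collect M. F)"
    using ctb by (intro countable_UN) (auto simp: M_def minimal_finite_def countable_finite)
  ultimately show "countable {B\<in>\<B>. B \<inter> K \<noteq> {}}" by (rule countable_subset)
qed

section \<open>Consequences of having a base\<close>

lemma point_countable_base_imp_Frechet_Urysohn:
  assumes base: "is_base X \<B>" and pc: "point_countable X \<B>"
  shows "Frechet_Urysohn X"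
  unfolding Frechet_Urysohn_def
proof (intro allI impI, elim conjE)
  fix A x assume A: "A \<subseteq> topspace X" "x \<in> X closure_of A"
  then have xX: "x \<in> topspace X" by (auto simp: in_closure_of)
  let ?D = "{B\<in>\<B>. x \<in> B}"
  have ne: "?D \<noteq> {}" using is_baseE[OF base openin_topspace xX] by blast
  have ctb: "countable ?D" using pc xX by (simp add: point_countable_def)
  define b where "b = from_nat_into ?D"
  have b: "range b = ?D" unfolding b_def using ne ctb by (rule range_from_nat_into)
  have op: "openin X (b i)" and xb: "x \<in> b i" for i
    using b is_base_openin[OF base, of "b i"] by auto
  \<comment> \<open>Point-countability makes the space first countable at \<open>x\<close>; the
    \<open>n\<close>-th term is taken in the first \<open>n + 1\<close> basic neighbourhoods at
    once.\<close>
  have "\<exists>y. y \<in> A \<and> (\<forall>i\<le>n. y \<in> b i)" for n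
  proof -
    have "openin X (\<Inter>(b ` {..n}))" by (rule openin_Inter) (use op in auto)
    moreover have "x \<in> \<Inter>(b ` {..n})" using xb by auto
    ultimately have "\<exists>y. y \<in> A \<and> y \<in> \<Inter>(b ` {..n})"
      using A(2) unfolding in_closure_of by blast
    then show ?thesis by auto
  qed
  then obtain f where f: "\<And>n. f n \<in> A" "\<And>n i. i \<le> n \<Longrightarrow> f n \<in> b i" by metis
  have "limitin X f x sequentially"
    unfolding limitin_sequentially
  proof (intro conjI allI impI, rule xX, elim conjE)
    fix U assume "openin X U" "x \<in> U"
    then obtain B where "B \<in> \<B>" "x \<in> B" "B \<subseteq> U" using base by (rule_tac is_baseE)
    moreover then obtain i where "B = b i" using b by blast
    ultimately show "\<exists>N. \<forall>n\<ge>N. f n \<in> U" using f(2) by blast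
  qed
  with f(1) show "\<exists>f. range f \<subseteq> A \<and> limitin X f x sequentially" by blast
qed

lemma base_imp_k_network:
  assumes base: "is_base X \<B>"
  shows "k_network X \<B>"
  unfolding k_network_def
proof (intro conjI allI impI ballI)
  show "P \<subseteq> topspace X" if "P \<in> \<B>" for P
    using is_base_openin[OF base that] by (rule openin_subset)
  fix K U assume KU: "compactin X K \<and> openin X U \<and> K \<subseteq> U"
  then have cov: "K \<subseteq> \<Union>{B\<in>\<B>. B \<subseteq> U}"
    using is_baseE[OF base] by (smt (verit, best) Union_iff mem_Collect_eq subset_eq)
  obtain F where "finite F" "F \<subseteq> {B\<in>\<B>. B \<subseteq> U}" "K \<subseteq> \<Union>F"
    using compactin_base_subcover[OF _ base _ cov] KU by (metis (no_types, lifting) mem_Collect_eq subsetI)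
  then show "\<exists>\<P>'. finite \<P>' \<and> \<P>' \<subseteq> \<B> \<and> K \<subseteq> \<Union>\<P>' \<and> \<Union>\<P>' \<subseteq> U"
    by (intro exI[of _ F] conjI) blast+
qed

lemma base_imp_weak_base:
  assumes base: "is_base X \<B>"
  shows "weak_base X (\<lambda>x. {B\<in>\<B>. x \<in> B})"
  unfolding weak_base_def
proof (intro conjI ballI allI impI)
  fix x U V assume "U \<in> {B\<in>\<B>. x \<in> B}" "V \<in> {B\<in>\<B>. x \<in> B}"
  then have "openin X (U \<inter> V)" "x \<in> U \<inter> V"
    using is_base_openin[OF base] by auto
  then show "\<exists>W\<in>{B\<in>\<B>. x \<in> B}. W \<subseteq> U \<inter> V"
    using base by (rule_tac is_baseE) auto
next
  fix G assume "G \<subseteq> topspace X \<and> (\<forall>y\<in>G. \<exists>P\<in>{B\<in>\<B>. y \<in> B}. P \<subseteq> G)"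
  then show "openin X G"
    using is_base_openin[OF base] by (subst openin_subopen) blast
next
  fix x U assume "openin X U \<and> x \<in> U"
  then show "\<exists>P\<in>{B\<in>\<B>. x \<in> B}. P \<subseteq> U"
    using is_baseE[OF base] by (metis (mono_tags, lifting) mem_Collect_eq)
qed (use openin_subset[OF is_base_openin[OF base]] in auto)

section \<open>Point-countable interior covers\<close>

abbreviation minimal_interior_cover ::
    "'a topology \<Rightarrow> 'a set set \<Rightarrow> 'a set \<Rightarrow> 'a set set \<Rightarrow> bool" where
  "minimal_interior_cover X \<P> A \<equiv> minimal_finite (\<lambda>F. A \<subseteq> X interior_of \<Union>F) \<P>"

lemma minimal_interior_cover_at_point:
  assumes "finite F" "F \<subseteq> \<P>" "x \<in> X interior_of \<Union>F"
  obtains E where "E \<subseteq> F" "minimal_interior_cover X \<P> {x} E"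
  using minimal_finite_subset[of F \<P> "\<lambda>F. {x} \<subseteq> X interior_of \<Union>F"] assms by blast

lemma Frechet_UrysohnE:
  assumes "Frechet_Urysohn X" "A \<subseteq> topspace X" "x \<in> X closure_of A"
  obtains f where "\<And>n::nat. f n \<in> A" "limitin X f x sequentially"
  using assms unfolding Frechet_Urysohn_def by (metis range_subsetD)

text \<open>If \<open>\<Union>R\<close> is not a neighbourhood of some \<open>x \<in> A\<close>, a
  sequence outside \<open>\<Union>R\<close> converges to \<open>x\<close>. An interior cover of
  \<open>A\<close> must catch a term of it, necessarily in a member outside \<open>R\<close>, and
  only countably many members of \<open>\<P>\<close> contain terms of the sequence.\<close>

lemma countable_minimal_interior_covers:
  assumes FU: "Frechet_Urysohn X" and pc: "point_countable X \<P>"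
  shows "countable {F. minimal_interior_cover X \<P> A F}"
proof (cases "A \<subseteq> topspace X")
  case False
  then have "{F. minimal_interior_cover X \<P> A F} = {}"
    using interior_of_subset_topspace[of X] unfolding minimal_finite_def by blast
  then show ?thesis by (metis countable_empty)
next
  case True
  show ?thesis
  proof (rule countable_minimal_finite)
    fix R assume "\<not> A \<subseteq> X interior_of \<Union>R"
    then obtain x where x: "x \<in> A" "x \<notin> X interior_of \<Union>R" by blast
    with True have "x \<in> X closure_of (topspace X - \<Union>R)"
      by (simp add: closure_of_complement subsetD)
    then obtain f :: "nat \<Rightarrow> 'a" where f: "\<And>n. f n \<in> topspace X - \<Union>R" "limitin X f x sequentially"
      using Frechet_UrysohnE[OF FU Diff_subset] by blast
    let ?S = "\<Union>n. {P\<in>\<P>. f n \<in> P}"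
    have S: "countable ?S"
      using pc f(1) by (auto simp: point_countable_def)
    have meet: "(F - R) \<inter> ?S \<noteq> {}" if F: "F \<subseteq> \<P>" "A \<subseteq> X interior_of \<Union>F" for F
    proof -
      have "\<forall>\<^sub>F n in sequentially. f n \<in> X interior_of \<Union>F"
        using limitinD[OF f(2)] F(2) x(1) by (simp add: subsetD)
      then obtain n where "f n \<in> X interior_of \<Union>F"
        by (auto simp: eventually_sequentially)
      then obtain P where P: "P \<in> F" "f n \<in> P"
        using interior_of_subset[of X "\<Union>F"] by blast
      then have "P \<notin> R" using f(1)[of n] by blast
      with P F(1) show ?thesis by blast
    qed
    show "\<exists>S. countable S \<and> (\<forall>F. finite F \<longrightarrow> F \<subseteq> \<P> \<longrightarrow> A \<subseteq> X interior_of \<Union>F \<longrightarrow>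
        R \<subseteq> F \<longrightarrow> (F - R) \<inter> S \<noteq> {})"
      by (intro exI[of _ ?S] conjI allI impI S meet)
  qed
qed

text \<open>Burke and Michael: if \<open>G\<close> witnesses that \<open>F\<close> is minimal at \<open>x\<close>, each member of \<open>G\<close>
  contains \<open>x\<close> and hence has \<open>F\<close> as a minimal interior cover, so that \<open>F\<close> can be recovered
  from any point of \<open>\<Union>G\<close> up to countably many choices.\<close>

lemma point_countable_base_of_pointed_interior_covers:
  assumes FU: "Frechet_Urysohn X" and pc: "point_countable X \<P>"
    and cov: "\<And>x U. openin X U \<Longrightarrow> x \<in> U \<Longrightarrow>
      \<exists>G. finite G \<and> G \<subseteq> \<P> \<and> x \<in> \<Inter>G \<and> x \<in> X interior_of \<Union>G \<and> \<Union>G \<subseteq> U"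
  shows "\<exists>\<B>. is_base X \<B> \<and> point_countable X \<B>"
proof -
  let ?m = "minimal_interior_cover X \<P>"
  define B where "B F = \<Union>{X interior_of \<Union>G |G. finite G \<and> G \<subseteq> \<P> \<and> (\<forall>P\<in>G. ?m P F)}" for F
  have B_sub: "\<exists>P\<in>\<P>. y \<in> P \<and> ?m P F" if "y \<in> B F" for y F
    using that interior_of_subset[of X] unfolding B_def by blast
  have "is_base X (range B)"
  proof (rule is_baseI)
    show "openin X C" if "C \<in> range B" for C
      using that by (auto simp: B_def)
    fix U x assume U: "openin X U" "x \<in> U"
    obtain F0 where F0: "finite F0" "F0 \<subseteq> \<P>" "x \<in> X interior_of \<Union>F0" "\<Union>F0 \<subseteq> U"
      using cov[OF U] by blast
    then obtain F where F: "F \<subseteq> F0" "?m {x} F"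
      using minimal_interior_cover_at_point by metis
    then have xF: "x \<in> X interior_of \<Union>F" by (simp add: minimal_finite_def)
    \<comment> \<open>The second use of \<open>cov\<close> is nested inside the interior of
      \<open>\<Union>F\<close>, so that \<open>F\<close> is an interior cover of every member of
      \<open>G\<close>.\<close>
    obtain G where G: "finite G" "G \<subseteq> \<P>" "x \<in> \<Inter>G" "x \<in> X interior_of \<Union>G"
        "\<Union>G \<subseteq> X interior_of \<Union>F"
      using cov[OF openin_interior_of xF] by blast
    \<comment> \<open>Minimality passes from \<open>x\<close> to \<open>P\<close> because
      \<open>x \<in> P\<close>: a proper subfamily of \<open>F\<close> that is an interior cover of
      \<open>P\<close> would be one of \<open>{x}\<close>.\<close>
    have "?m P F" if "P \<in> G" for P
      using that F(2) G(3,5) unfolding minimal_finite_def by blast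
    then have "x \<in> B F" unfolding B_def using G by blast
    moreover have "B F \<subseteq> U"
    proof
      fix y assume "y \<in> B F"
      then obtain P where "y \<in> P" "?m P F" using B_sub by blast
      then have "y \<in> X interior_of \<Union>F" by (auto simp: minimal_finite_def)
      then show "y \<in> U" using interior_of_subset[of X "\<Union>F"] F(1) F0(4) by blast
    qed
    ultimately show "\<exists>C\<in>range B. x \<in> C \<and> C \<subseteq> U" by blast
  qed
  moreover have "point_countable X (range B)"
    unfolding point_countable_def
  proof
    fix y assume y: "y \<in> topspace X"
    have "{C\<in>range B. y \<in> C} \<subseteq> B ` (\<Union>P\<in>{P\<in>\<P>. y \<in> P}. {F. ?m P F})"
      using B_sub by blast
    moreover have "countable \<dots>"
      using pc y countable_minimal_interior_covers[OF FU pc]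
      by (intro countable_image countable_UN) (auto simp: point_countable_def)
    ultimately show "countable {C\<in>range B. y \<in> C}" by (rule countable_subset)
  qed
  ultimately show ?thesis by blast
qed

text \<open>The covers are replaced by pointed ones, whose members all contain \<open>x\<close>, by
  passing from \<open>\<P>\<close> to the sets \<open>Q E\<close>. Regularity keeps the closures
  involved inside \<open>U\<close>. Point-countability survives: if \<open>y \<in> Q E\<close>, then
  \<open>E\<close> is a subfamily of one of the countably many minimal interior covers of
  \<open>{y}\<close>, each of which is finite.\<close>

lemma point_countable_base_of_interior_covers:
  assumes reg: "regular_space X" and FU: "Frechet_Urysohn X" and pc: "point_countable X \<P>"
    and cov: "\<And>x U. openin X U \<Longrightarrow> x \<in> U \<Longrightarrow>
      \<exists>F. finite F \<and> F \<subseteq> \<P> \<and> x \<in> X interior_of \<Union>F \<and> \<Union>F \<subseteq> U"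
  shows "\<exists>\<B>. is_base X \<B> \<and> point_countable X \<B>"
proof -
  let ?m = "\<lambda>x. minimal_interior_cover X \<P> {x}"
  have m_int: "x \<in> X interior_of \<Union>F" if "?m x F" for x F
    using that by (simp add: minimal_finite_def)
  \<comment> \<open>Taking the closure and allowing \<open>F\<close> to be larger than
    \<open>E\<close> lets \<open>x\<close> belong to \<open>Q E\<close> even if \<open>E\<close> is
    not itself an interior cover of \<open>{x}\<close>.\<close>
  define Q where "Q E = {y \<in> X closure_of \<Union>E. \<exists>F. E \<subseteq> F \<and> ?m y F}" for E
  show ?thesis
  proof (rule point_countable_base_of_pointed_interior_covers[OF FU])
    show "point_countable X (range Q)"
      unfolding point_countable_def
    proof
      fix y
      have "{C\<in>range Q. y \<in> C} \<subseteq> Q ` (\<Union>F\<in>{F. ?m y F}. Pow F)"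
        unfolding Q_def by blast
      moreover have "countable (Q ` (\<Union>F\<in>{F. ?m y F}. Pow F))"
        using countable_minimal_interior_covers[OF FU pc, of "{y}"]
        by (intro countable_image countable_UN) (auto simp: minimal_finite_def countable_finite)
      ultimately show "countable {C\<in>range Q. y \<in> C}" by (rule countable_subset)
    qed
  next
    fix x U assume U: "openin X U" "x \<in> U"
    then obtain V C where V: "openin X V" "closedin X C" "x \<in> V" "V \<subseteq> C" "C \<subseteq> U"
      using reg by (metis neighbourhood_base_of neighbourhood_base_of_closedin)
    then obtain F0 where F0: "finite F0" "F0 \<subseteq> \<P>" "x \<in> X interior_of \<Union>F0" "\<Union>F0 \<subseteq> V"
      using cov by metis
    then obtain F where F: "F \<subseteq> F0" "?m x F"
      using minimal_interior_cover_at_point by metis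
    then have "finite F" "F \<subseteq> \<P>" by (auto simp: minimal_finite_def)
    have clF: "X closure_of \<Union>F \<subseteq> U"
      using V F(1) F0(4) closure_of_minimal[of "\<Union>F" C X] by blast
    define M where "M E = {y. ?m y E}" for E
    have M_cl: "X closure_of M E \<subseteq> X closure_of \<Union>E" for E
      using m_int[of _ E] interior_of_subset[of X "\<Union>E"]
      by (intro closure_of_mono) (auto simp only: M_def)
    define \<E> where "\<E> = {E. E \<subseteq> F \<and> x \<in> X closure_of M E}"
    \<comment> \<open>Only the finitely many closures of \<open>M E\<close> that miss
      \<open>x\<close> are removed, so \<open>N\<close> is a neighbourhood of \<open>x\<close>. Each
      \<open>y \<in> N\<close> has a minimal interior cover \<open>E \<subseteq> F\<close>, and
      \<open>y \<in> M E\<close> then forces \<open>E \<in> \<E>\<close>.\<close>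
    define N where "N = X interior_of \<Union>F - \<Union>((\<lambda>E. X closure_of M E) ` (Pow F - \<E>))"
    have "openin X N"
      unfolding N_def using \<open>finite F\<close>
      by (intro openin_diff openin_interior_of closedin_Union) auto
    moreover have "x \<in> N"
      using m_int[OF F(2)] by (auto simp: N_def \<E>_def)
    moreover have "N \<subseteq> \<Union>(Q ` \<E>)"
    proof
      fix y assume y: "y \<in> N"
      then have yF: "y \<in> X interior_of \<Union>F" by (simp add: N_def)
      obtain E where E: "E \<subseteq> F" "?m y E"
        using minimal_interior_cover_at_point[OF \<open>finite F\<close> \<open>F \<subseteq> \<P>\<close> yF] by blast
      have ytop: "y \<in> topspace X" using yF interior_of_subset_topspace by (rule rev_subsetD)
      have yM: "y \<in> X closure_of M E"
        using E(2) ytop by (auto simp: M_def in_closure_of)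
      then have "E \<in> \<E>" using y E(1) unfolding N_def by blast
      moreover have "y \<in> Q E"
        using E(2) M_cl yM by (auto simp: Q_def)
      ultimately show "y \<in> \<Union>(Q ` \<E>)" by blast
    qed
    ultimately have "x \<in> X interior_of \<Union>(Q ` \<E>)"
      by (auto simp: interior_of_def)
    moreover have "x \<in> \<Inter>(Q ` \<E>)"
      using F(2) M_cl by (auto simp: Q_def \<E>_def)
    moreover have "\<Union>(Q ` \<E>) \<subseteq> U"
    proof -
      have "Q E \<subseteq> X closure_of \<Union>F" if "E \<in> \<E>" for E
        using that closure_of_mono[of "\<Union>E" "\<Union>F" X] by (auto simp: Q_def \<E>_def)
      then show ?thesis using clF by blast
    qed
    moreover have "finite (Q ` \<E>)"
      using \<open>finite F\<close> by (auto simp: \<E>_def)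
    ultimately show "\<exists>G. finite G \<and> G \<subseteq> range Q \<and> x \<in> \<Inter>G \<and> x \<in> X interior_of \<Union>G \<and> \<Union>G \<subseteq> U"
      by (intro exI[of _ "Q ` \<E>"]) auto
  qed
qed

section \<open>Strongly Frechet spaces with a point-countable k-network\<close>

text \<open>These spaces are also known as countably bi-sequential.\<close>

definition strongly_Frechet :: "'a topology \<Rightarrow> bool" where
  "strongly_Frechet X \<longleftrightarrow> (\<forall>A x. (\<forall>n::nat. A n \<subseteq> topspace X \<and> x \<in> X closure_of A n) \<and> decseq A \<longrightarrow>
     (\<exists>f. (\<forall>n. f n \<in> A n) \<and> limitin X f x sequentially))"

lemma strongly_Frechet_imp_Frechet_Urysohn:
  assumes "strongly_Frechet X"
  shows "Frechet_Urysohn X"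
  unfolding Frechet_Urysohn_def
proof (intro allI impI, elim conjE)
  fix A x assume "A \<subseteq> topspace X" "x \<in> X closure_of A"
  then show "\<exists>f. range f \<subseteq> A \<and> limitin X f x sequentially"
    using assms[unfolded strongly_Frechet_def, rule_format, of "\<lambda>_. A" x]
    by (auto simp: decseq_def)
qed

text \<open>If no finite subfamily inside \<open>U\<close> works, closing off under sequences that
  witness these failures yields a countable set \<open>AA\<close> such that \<open>x\<close> stays
  in the closure of \<open>AA\<close> after any finitely many members inside \<open>U\<close> that
  meet \<open>AA\<close> are removed. A sequence from \<open>AA\<close> converging to
  \<open>x\<close> can then avoid more and more of these members, against the finite cover that the
  k-network gives for a tail of it together with \<open>x\<close>.\<close>

lemma interior_covers_of_k_network:
  assumes sF: "strongly_Frechet X" and kn: "k_network X \<P>" and pc: "point_countable X \<P>"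
    and U: "openin X U" "x \<in> U"
  shows "\<exists>F. finite F \<and> F \<subseteq> \<P> \<and> x \<in> X interior_of \<Union>F \<and> \<Union>F \<subseteq> U"
proof (rule ccontr)
  assume contra: "\<not> ?thesis"
  have FU: "Frechet_Urysohn X" using sF by (rule strongly_Frechet_imp_Frechet_Urysohn)
  have xX: "x \<in> topspace X" using U openin_subset by blast
  let ?PU = "{P\<in>\<P>. P \<subseteq> U}"
  have "\<exists>s::nat \<Rightarrow> 'a. finite R \<longrightarrow> R \<subseteq> ?PU \<longrightarrow>
      range s \<subseteq> topspace X - \<Union>R \<and> limitin X s x sequentially" for R
  proof (cases "finite R \<and> R \<subseteq> ?PU")
    case True
    then have "x \<notin> X interior_of \<Union>R" using contra by blast
    with xX have "x \<in> X closure_of (topspace X - \<Union>R)"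
      by (simp add: closure_of_complement)
    with FU show ?thesis by (auto simp: Frechet_Urysohn_def)
  qed auto
  then obtain s :: "'a set set \<Rightarrow> nat \<Rightarrow> 'a" where
    s: "\<And>R. finite R \<Longrightarrow> R \<subseteq> ?PU \<Longrightarrow> range (s R) \<subseteq> topspace X - \<Union>R \<and> limitin X (s R) x sequentially"
    by metis
  define meet where "meet A = {P\<in>?PU. P \<inter> A \<noteq> {}}" for A
  have meet: "countable (meet A)" if "countable A" "A \<subseteq> topspace X" for A
  proof -
    have "meet A \<subseteq> (\<Union>a\<in>A. {P\<in>\<P>. a \<in> P})" by (auto simp: meet_def)
    moreover have "countable \<dots>"
      using that pc by (auto simp: point_countable_def)
    ultimately show ?thesis by (rule countable_subset)
  qed
  \<comment> \<open>Only finite families of members meeting the current set are treated, so each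
    stage adds countably many points.\<close>
  define step where "step A = A \<union> (\<Union>R\<in>{R. finite R \<and> R \<subseteq> meet A}. range (s R))" for A
  define A where "A n = (step ^^ n) {}" for n
  have A_Suc: "A (Suc n) = step (A n)" for n by (simp add: A_def)
  have A: "countable (A n) \<and> A n \<subseteq> topspace X" for n
  proof (induction n)
    case (Suc n)
    then have "countable {R. finite R \<and> R \<subseteq> meet (A n)}"
      by (intro countable_Collect_finite_subset meet) auto
    moreover have "range (s R) \<subseteq> topspace X" if "finite R" "R \<subseteq> meet (A n)" for R
      using s[of R] that by (auto simp: meet_def)
    ultimately show ?case using Suc unfolding A_Suc step_def by auto
  qed (simp add: A_def)
  define AA where "AA = (\<Union>n. A n)"
  have AA: "countable AA" "AA \<subseteq> topspace X" using A by (auto simp: AA_def)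
  have A_mono: "A m \<subseteq> A n" if "m \<le> n" for m n
    using that by (rule lift_Suc_mono_le[rotated]) (auto simp: A_Suc step_def)
  have AA_cl: "x \<in> X closure_of (AA - \<Union>R)" if R: "finite R" "R \<subseteq> meet AA" for R
  proof -
    \<comment> \<open>A finite \<open>R\<close> is already met by one stage \<open>A n\<close> of
      the increasing union, so the sequence \<open>s R\<close> was added at stage
      \<open>Suc n\<close>.\<close>
    have "\<exists>n. R \<subseteq> meet (A n)"
      using R
    proof (induction R)
      case (insert P R)
      then obtain n where "R \<subseteq> meet (A n)" by auto
      moreover from insert have "P \<in> meet AA" by auto
      then obtain m where "P \<in> meet (A m)" by (auto simp: meet_def AA_def)
      moreover have "meet (A k) \<subseteq> meet (A (max m n))" if "k \<in> {m,n}" for k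
      proof -
        have "A k \<subseteq> A (max m n)" using that by (intro A_mono) auto
        then show ?thesis unfolding meet_def by blast
      qed
      ultimately show ?case by (intro exI[of _ "max m n"]) blast
    qed auto
    then obtain n where n: "R \<subseteq> meet (A n)" ..
    then have sR: "range (s R) \<subseteq> topspace X - \<Union>R" "limitin X (s R) x sequentially"
      using s[of R] R(1) by (auto simp: meet_def)
    have "range (s R) \<subseteq> A (Suc n)"
      using n R(1) by (auto simp: A_Suc step_def)
    then have "s R k \<in> AA - \<Union>R" for k
      using sR(1) by (auto simp: AA_def)
    then show ?thesis
      unfolding in_closure_of using xX limitinD[OF sR(2)]
      by (metis eventually_sequentially order_refl)
  qed
  \<comment> \<open>An injective numbering makes each \<open>R n\<close> finite, while every member
    of \<open>meet AA\<close> belongs to \<open>R n\<close> for all large \<open>n\<close>.\<close>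
  obtain \<phi> :: "'a set \<Rightarrow> nat" where \<phi>: "inj_on \<phi> (meet AA)"
    using meet[OF AA] by (auto simp: countable_def)
  define R where "R n = {P\<in>meet AA. \<phi> P \<le> n}" for n
  have "R n = \<phi> -` {..n} \<inter> meet AA" for n by (auto simp: R_def)
  then have Rfin: "finite (R n)" for n
    using \<phi> by (simp add: finite_vimage_IntI)
  have "decseq (\<lambda>n. AA - \<Union>(R n))"
    by (force simp: decseq_def R_def)
  moreover have "x \<in> X closure_of (AA - \<Union>(R n))" for n
    using Rfin by (intro AA_cl) (auto simp: R_def)
  ultimately obtain y where y: "\<And>n. y n \<in> AA - \<Union>(R n)" "limitin X y x sequentially"
    using sF[unfolded strongly_Frechet_def, rule_format, of "\<lambda>n. AA - \<Union>(R n)" x] AA by blast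
  obtain N where N: "\<And>n. n \<ge> N \<Longrightarrow> y n \<in> U"
    using limitinD[OF y(2) U] by (auto simp: eventually_sequentially)
  have "compactin X (insert x (y ` {N..}))"
    using y(1) AA by (intro compactin_sequence_with_limit[OF y(2)]) auto
  moreover have "insert x (y ` {N..}) \<subseteq> U" using N U by auto
  ultimately obtain F where F: "finite F" "F \<subseteq> \<P>" "insert x (y ` {N..}) \<subseteq> \<Union>F" "\<Union>F \<subseteq> U"
    using kn U unfolding k_network_def by meson
  obtain m where m: "\<And>P. P \<in> F \<Longrightarrow> \<phi> P \<le> m"
    using F(1) by (metis Max_ge finite_imageI imageI)
  \<comment> \<open>The index is at least \<open>N\<close>, so the term is covered by
    \<open>F\<close>, and at least \<open>m\<close>, so the term avoids every member of
    \<open>F\<close> that meets \<open>AA\<close>.\<close>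
  have "y (max m N) \<in> y ` {N..}" by simp
  then obtain P where P: "P \<in> F" "y (max m N) \<in> P" using F(3) by blast
  then have "P \<in> R (max m N)"
    using y(1)[of "max m N"] F m[OF P(1)] by (auto simp: R_def meet_def)
  with P y(1)[of "max m N"] show False by blast
qed

section \<open>Passage to subspaces and comparison of countability conditions\<close>

lemma Frechet_Urysohn_subtopology:
  assumes "Frechet_Urysohn X"
  shows "Frechet_Urysohn (subtopology X S)"
  unfolding Frechet_Urysohn_def
proof (intro allI impI, elim conjE)
  fix A x assume A: "A \<subseteq> topspace (subtopology X S)" "x \<in> subtopology X S closure_of A"
  then have "A \<subseteq> S" by auto
  then have x: "x \<in> S" "x \<in> X closure_of A"
    using A(2) by (auto simp: closure_of_subtopology Int_absorb1)
  obtain f :: "nat \<Rightarrow> 'a" where "\<And>n. f n \<in> A" "limitin X f x sequentially"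
    using A(1) x(2) assms Frechet_UrysohnE[of X A x] by auto
  then show "\<exists>f. range f \<subseteq> A \<and> limitin (subtopology X S) f x sequentially"
    using x(1) \<open>A \<subseteq> S\<close> by (intro exI[of _ f]) (auto simp: limitin_subtopology intro!: always_eventually)
qed

lemma k_network_subtopology:
  assumes kn: "k_network X \<P>"
  shows "k_network (subtopology X S) ((\<lambda>P. P \<inter> S) ` \<P>)"
  unfolding k_network_def
proof (intro conjI allI impI ballI)
  show "P \<subseteq> topspace (subtopology X S)" if "P \<in> (\<lambda>P. P \<inter> S) ` \<P>" for P
    using kn that by (auto simp: k_network_def)
  fix K U assume KU: "compactin (subtopology X S) K \<and> openin (subtopology X S) U \<and> K \<subseteq> U"
  then obtain V where V: "openin X V" "U = V \<inter> S"
    by (auto simp: openin_subtopology)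
  with KU have "compactin X K" "K \<subseteq> V" "K \<subseteq> S" by (auto simp: compactin_subtopology)
  then obtain F where F: "finite F" "F \<subseteq> \<P>" "K \<subseteq> \<Union>F" "\<Union>F \<subseteq> V"
    using kn V unfolding k_network_def by meson
  show "\<exists>\<P>'. finite \<P>' \<and> \<P>' \<subseteq> (\<lambda>P. P \<inter> S) ` \<P> \<and> K \<subseteq> \<Union>\<P>' \<and> \<Union>\<P>' \<subseteq> U"
  proof (intro exI conjI)
    show "finite ((\<lambda>P. P \<inter> S) ` F)" using F by simp
    show "(\<lambda>P. P \<inter> S) ` F \<subseteq> (\<lambda>P. P \<inter> S) ` \<P>" using F by blast
    show "K \<subseteq> \<Union>((\<lambda>P. P \<inter> S) ` F)" using F(3) \<open>K \<subseteq> S\<close> by blast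
    show "\<Union>((\<lambda>P. P \<inter> S) ` F) \<subseteq> U" using F(4) V(2) by blast
  qed
qed

lemma point_countable_subtopology:
  assumes "point_countable X \<P>"
  shows "point_countable (subtopology X S) ((\<lambda>P. P \<inter> S) ` \<P>)"
  unfolding point_countable_def
proof
  fix x assume "x \<in> topspace (subtopology X S)"
  then have "countable ((\<lambda>P. P \<inter> S) ` {P\<in>\<P>. x \<in> P})"
    using assms by (auto simp: point_countable_def)
  moreover have "{Q\<in>(\<lambda>P. P \<inter> S) ` \<P>. x \<in> Q} \<subseteq> (\<lambda>P. P \<inter> S) ` {P\<in>\<P>. x \<in> P}" by blast
  ultimately show "countable {Q\<in>(\<lambda>P. P \<inter> S) ` \<P>. x \<in> Q}" by (rule countable_subset[rotated])
qed

lemma compact_countable_imp_point_countable: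
  assumes "compact_countable X \<P>"
  shows "point_countable X \<P>"
  unfolding point_countable_def
proof
  fix x assume "x \<in> topspace X"
  then have "countable {P\<in>\<P>. P \<inter> {x} \<noteq> {}}"
    using assms[unfolded compact_countable_def, rule_format, of "{x}"] by simp
  then show "countable {P\<in>\<P>. x \<in> P}" by simp
qed

section \<open>The Vietoris topology\<close>

lemma openin_vietoris_basic:
  assumes "finite Us" "Us \<noteq> {}" "\<And>U. U \<in> Us \<Longrightarrow> openin X U"
  shows "openin (vietoris X) (vietoris_basic X Us)"
  unfolding vietoris_def using assms by (intro topology_generated_by_Basis) blast

lemma topspace_vietoris: "topspace (vietoris X) = {K. compactin X K \<and> K \<noteq> {}}"
proof
  show "topspace (vietoris X) \<subseteq> {K. compactin X K \<and> K \<noteq> {}}"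
    by (auto simp: vietoris_def vietoris_basic_def)
  have "openin (vietoris X) (vietoris_basic X {topspace X})"
    by (intro openin_vietoris_basic) auto
  moreover have "{K. compactin X K \<and> K \<noteq> {}} \<subseteq> vietoris_basic X {topspace X}"
    using compactin_subset_topspace by (fastforce simp: vietoris_basic_def)
  ultimately show "{K. compactin X K \<and> K \<noteq> {}} \<subseteq> topspace (vietoris X)"
    using openin_subset by blast
qed

text \<open>Trimming each set to the union of the other family enforces both inclusions at once, and
  the trace of a set \<open>K\<close> lying in both unions is unchanged by the trimming.\<close>

lemma vietoris_basic_Int:
  "vietoris_basic X Us \<inter> vietoris_basic X Vs =
   vietoris_basic X ((\<lambda>U. U \<inter> \<Union>Vs) ` Us \<union> (\<lambda>V. V \<inter> \<Union>Us) ` Vs)"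
    (is "_ = vietoris_basic X ?Ws")
proof -
  have un: "\<Union>?Ws = \<Union>Us \<inter> \<Union>Vs" by blast
  have meet: "(\<forall>W\<in>?Ws. K \<inter> W \<noteq> {}) \<longleftrightarrow> (\<forall>U\<in>Us. K \<inter> U \<noteq> {}) \<and> (\<forall>V\<in>Vs. K \<inter> V \<noteq> {})"
    if "K \<subseteq> \<Union>Us" "K \<subseteq> \<Union>Vs" for K
  proof -
    have "K \<inter> (U \<inter> \<Union>Vs) = K \<inter> U" "K \<inter> (U \<inter> \<Union>Us) = K \<inter> U" for U
      using that by auto
    then show ?thesis by (simp add: ball_Un)
  qed
  show ?thesis
  proof (intro set_eqI)
    fix K
    show "K \<in> vietoris_basic X Us \<inter> vietoris_basic X Vs \<longleftrightarrow> K \<in> vietoris_basic X ?Ws"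
      unfolding vietoris_basic_def un Int_iff mem_Collect_eq le_inf_iff using meet[of K] by argo
  qed
qed

text \<open>The generating sets are closed under binary intersection, so induction over the
  generated topology shows that they form a base.\<close>

lemma vietoris_basic_nbhd:
  assumes "openin (vietoris X) W" "K \<in> W"
  obtains Us where "finite Us" "Us \<noteq> {}" "\<And>U. U \<in> Us \<Longrightarrow> openin X U"
    "K \<in> vietoris_basic X Us" "vietoris_basic X Us \<subseteq> W"
proof -
  define nb where "nb K W \<longleftrightarrow> (\<exists>Us. finite Us \<and> Us \<noteq> {} \<and> (\<forall>U\<in>Us. openin X U) \<and>
    K \<in> vietoris_basic X Us \<and> vietoris_basic X Us \<subseteq> W)" for K W
  have "generate_topology_on
      {vietoris_basic X Us | Us. finite Us \<and> Us \<noteq> {} \<and> (\<forall>U\<in>Us. openin X U)} W"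
    using assms(1) by (simp add: vietoris_def openin_topology_generated_by_iff)
  then have "\<forall>K\<in>W. nb K W"
  proof induction
    case (Int V W)
    show ?case
    proof
      fix K assume "K \<in> V \<inter> W"
      with Int.IH have "nb K V" "nb K W" by auto
      then obtain Us Vs where
        Us: "finite Us" "Us \<noteq> {}" "\<forall>U\<in>Us. openin X U" "K \<in> vietoris_basic X Us" "vietoris_basic X Us \<subseteq> V"
        and Vs: "finite Vs" "Vs \<noteq> {}" "\<forall>U\<in>Vs. openin X U" "K \<in> vietoris_basic X Vs" "vietoris_basic X Vs \<subseteq> W"
        unfolding nb_def by (elim exE conjE) (rule that)
      let ?Ws = "(\<lambda>U. U \<inter> \<Union>Vs) ` Us \<union> (\<lambda>V. V \<inter> \<Union>Us) ` Vs"
      have "openin X U" if "U \<in> ?Ws" for U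
        using that Us(3) Vs(3) by (auto intro!: openin_Int openin_Union)
      moreover have "finite ?Ws" "?Ws \<noteq> {}" using Us(1,2) Vs(1) by auto
      moreover have "K \<in> vietoris_basic X ?Ws" "vietoris_basic X ?Ws \<subseteq> V \<inter> W"
        using Us(4,5) Vs(4,5) unfolding vietoris_basic_Int[symmetric] by auto
      ultimately show "nb K (V \<inter> W)"
        unfolding nb_def by (intro exI[of _ ?Ws] conjI ballI)
    qed
  next
    case (UN \<K>)
    have "nb K (\<Union>\<K>)" if "nb K V" "V \<in> \<K>" for K V
      using that unfolding nb_def by (meson Union_upper subset_trans)
    with UN.IH show ?case by blast
  next
    case (Basis W)
    then obtain Us where "finite Us" "Us \<noteq> {}" "\<forall>U\<in>Us. openin X U" "W = vietoris_basic X Us"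
      by blast
    then show ?case unfolding nb_def by (intro ballI exI[of _ Us]) simp
  qed simp
  with assms(2) have "nb K W" by blast
  then show ?thesis unfolding nb_def using that by (elim exE conjE) (rule that, auto)
qed

text \<open>All sets of a basic neighbourhood of \<open>{x}\<close> contain \<open>x\<close>, and a
  nonempty compact subset of their intersection meets each of them.\<close>

lemma vietoris_nbhd_singleton:
  assumes W: "openin (vietoris X) W" "{x} \<in> W"
  obtains N where "openin X N" "x \<in> N" "\<And>K. compactin X K \<Longrightarrow> K \<noteq> {} \<Longrightarrow> K \<subseteq> N \<Longrightarrow> K \<in> W"
proof -
  obtain Us where Us: "finite Us" "Us \<noteq> {}" "\<And>U. U \<in> Us \<Longrightarrow> openin X U"
    "{x} \<in> vietoris_basic X Us" "vietoris_basic X Us \<subseteq> W"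
    using vietoris_basic_nbhd[OF W] by metis
  show ?thesis
  proof
    show "openin X (\<Inter>Us)" using Us by (intro openin_Inter) auto
    show "x \<in> \<Inter>Us" using Us(4) by (auto simp: vietoris_basic_def)
    fix K assume K: "compactin X K" "K \<noteq> {}" "K \<subseteq> \<Inter>Us"
    obtain U where "U \<in> Us" using Us(2) by blast
    with K have "K \<in> vietoris_basic X Us" unfolding vietoris_basic_def by blast
    with Us(5) show "K \<in> W" by blast
  qed
qed

lemma eventually_subset_if_limitin_vietoris:
  assumes lim: "limitin (vietoris X) f K F" and U: "openin X U" "K \<subseteq> U"
  shows "\<forall>\<^sub>F n in F. f n \<subseteq> U"
proof -
  have "K \<in> vietoris_basic X {U}"
    using limitin_topspace[OF lim] U(2) by (auto simp: topspace_vietoris vietoris_basic_def)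
  then have "\<forall>\<^sub>F n in F. f n \<in> vietoris_basic X {U}"
    using U(1) by (intro limitinD[OF lim] openin_vietoris_basic) auto
  then show ?thesis by (rule eventually_mono) (simp add: vietoris_basic_def)
qed

lemma compactin_insert:
  assumes "compactin X T" "x \<in> topspace X"
  shows "compactin X (insert x T)"
  using compactin_Un[of X "{x}" T] assms by simp

lemma limitin_vietoris_insert:
  assumes s: "limitin X s y F" and T: "compactin X T"
  shows "limitin (vietoris X) (\<lambda>m. insert (s m) T) (insert y T) F"
  unfolding limitin_def
proof (intro conjI allI impI)
  show "insert y T \<in> topspace (vietoris X)"
    using compactin_insert[OF T limitin_topspace[OF s]] by (simp add: topspace_vietoris)
  fix W assume W: "openin (vietoris X) W \<and> insert y T \<in> W"
  then obtain Us where Us: "finite Us" "Us \<noteq> {}" "\<And>U. U \<in> Us \<Longrightarrow> openin X U"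
    "insert y T \<in> vietoris_basic X Us" "vietoris_basic X Us \<subseteq> W"
    using vietoris_basic_nbhd by metis
  \<comment> \<open>Only the sets through \<open>y\<close> constrain \<open>s m\<close>; every other
    member of \<open>Us\<close> is already met by \<open>T\<close>.\<close>
  define N where "N = \<Inter>{U\<in>Us. y \<in> U}"
  have y: "{U\<in>Us. y \<in> U} \<noteq> {}" using Us(4) by (auto simp: vietoris_basic_def)
  have "openin X N" unfolding N_def using Us y by (intro openin_Inter) auto
  moreover have "y \<in> N" by (simp add: N_def)
  ultimately have "\<forall>\<^sub>F m in F. s m \<in> N" using limitinD[OF s] by blast
  then show "\<forall>\<^sub>F m in F. insert (s m) T \<in> W"
  proof (rule eventually_mono)
    fix m assume m: "s m \<in> N"
    then have "s m \<in> topspace X" using \<open>openin X N\<close> openin_subset by blast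
    with T have "compactin X (insert (s m) T)" by (rule compactin_insert)
    moreover have "insert (s m) T \<subseteq> \<Union>Us"
      using m y Us(4) unfolding N_def vietoris_basic_def by blast
    moreover have "insert (s m) T \<inter> U \<noteq> {}" if "U \<in> Us" for U
    proof (cases "y \<in> U")
      case True
      then show ?thesis using m that unfolding N_def by blast
    next
      case False
      then show ?thesis using Us(4) that unfolding vietoris_basic_def by blast
    qed
    ultimately have "insert (s m) T \<in> vietoris_basic X Us"
      unfolding vietoris_basic_def by blast
    with Us(5) show "insert (s m) T \<in> W" by blast
  qed
qed

lemma continuous_map_singleton: "continuous_map X (vietoris X) (\<lambda>x. {x})"
  unfolding continuous_map
proof (intro conjI allI impI)
  show "(\<lambda>x. {x}) ` topspace X \<subseteq> topspace (vietoris X)"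
    by (auto simp: topspace_vietoris)
  fix W assume W: "openin (vietoris X) W"
  show "openin X {x \<in> topspace X. {x} \<in> W}"
  proof (subst openin_subopen, intro ballI)
    fix x assume "x \<in> {x \<in> topspace X. {x} \<in> W}"
    then have "{x} \<in> W" by simp
    then obtain N where N: "openin X N" "x \<in> N"
      "\<And>K. compactin X K \<Longrightarrow> K \<noteq> {} \<Longrightarrow> K \<subseteq> N \<Longrightarrow> K \<in> W"
      using vietoris_nbhd_singleton[OF W] by metis
    then have "N \<subseteq> {x \<in> topspace X. {x} \<in> W}"
      using openin_subset[OF N(1)] by (auto intro!: N(3))
    with N show "\<exists>T. openin X T \<and> x \<in> T \<and> T \<subseteq> {x \<in> topspace X. {x} \<in> W}" by blast
  qed
qed

text \<open>A point \<open>p \<in> K - L\<close> is separated from the compact set \<open>L\<close>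
  by \<open>U\<close> and \<open>V\<close>. No set can both meet \<open>U\<close> and lie inside
  \<open>V\<close>.\<close>

lemma Hausdorff_space_vietoris:
  assumes haus: "Hausdorff_space X"
  shows "Hausdorff_space (vietoris X)"
proof -
  have sep: "\<exists>U V. openin (vietoris X) U \<and> openin (vietoris X) V \<and> K \<in> U \<and> L \<in> V \<and> disjnt U V"
    if K: "compactin X K" "K \<noteq> {}" and L: "compactin X L" "L \<noteq> {}" and "\<not> K \<subseteq> L" for K L
  proof -
    obtain p where p: "p \<in> K" "p \<notin> L" using \<open>\<not> K \<subseteq> L\<close> by blast
    have "p \<in> topspace X" using p K compactin_subset_topspace by blast
    then have "compactin X {p}" "disjnt {p} L" using p by auto
    then obtain U V where UV: "openin X U" "openin X V" "p \<in> U" "L \<subseteq> V" "disjnt U V"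
      using haus L(1) unfolding Hausdorff_space_compact_sets by (metis insert_subset)
    \<comment> \<open>Adding \<open>topspace X\<close> to the family makes the inclusion condition
      vacuous, leaving only that \<open>U\<close> is met.\<close>
    have "openin (vietoris X) (vietoris_basic X {topspace X, U})" "openin (vietoris X) (vietoris_basic X {V})"
      using UV by (auto intro!: openin_vietoris_basic)
    moreover have "K \<in> vietoris_basic X {topspace X, U}" "L \<in> vietoris_basic X {V}"
      using K L UV p compactin_subset_topspace[OF K(1)] unfolding vietoris_basic_def by auto
    moreover have "disjnt (vietoris_basic X {topspace X, U}) (vietoris_basic X {V})"
      using UV(5) unfolding disjnt_def vietoris_basic_def by auto
    ultimately show ?thesis by blast
  qed
  show ?thesis
    unfolding Hausdorff_space_def
  proof (intro allI impI, elim conjE)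
    fix K L assume "K \<in> topspace (vietoris X)" "L \<in> topspace (vietoris X)" "K \<noteq> L"
    then have KL: "compactin X K" "K \<noteq> {}" "compactin X L" "L \<noteq> {}" "\<not> K \<subseteq> L \<or> \<not> L \<subseteq> K"
      by (auto simp: topspace_vietoris)
    then show "\<exists>U V. openin (vietoris X) U \<and> openin (vietoris X) V \<and> K \<in> U \<and> L \<in> V \<and> disjnt U V"
      using sep[of K L] sep[of L K] disjnt_sym by metis
  qed
qed

text \<open>Basic sets spanned by finite subfamilies of \<open>\<B>\<close> suffice. If
  \<open>K\<close> lies in one of them, all the members spanning it meet \<open>K\<close>. By
  compact-countability there are only countably many such members, hence countably many finite
  families of them.\<close>

lemma point_countable_base_vietoris:
  assumes T1: "t1_space X" and base: "is_base X \<B>" and pc: "point_countable X \<B>"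
  shows "\<exists>\<C>. is_base (vietoris X) \<C> \<and> point_countable (vietoris X) \<C>"
proof -
  define \<C> where "\<C> = vietoris_basic X ` {F. finite F \<and> F \<noteq> {} \<and> F \<subseteq> \<B>}"
  have "is_base (vietoris X) \<C>"
  proof (rule is_baseI)
    show "openin (vietoris X) C" if "C \<in> \<C>" for C
      using that is_base_openin[OF base] unfolding \<C>_def
      by (auto intro!: openin_vietoris_basic)
    fix W K assume "openin (vietoris X) W" "K \<in> W"
    then obtain Us where Us: "finite Us" "Us \<noteq> {}" "\<And>U. U \<in> Us \<Longrightarrow> openin X U"
      "K \<in> vietoris_basic X Us" "vietoris_basic X Us \<subseteq> W"
      using vietoris_basic_nbhd by metis
    then have K: "compactin X K" "K \<noteq> {}" "K \<subseteq> \<Union>Us" "\<And>U. U \<in> Us \<Longrightarrow> K \<inter> U \<noteq> {}"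
      by (auto simp: vietoris_basic_def)
    have "\<exists>B. B \<in> \<B> \<and> p \<in> B \<and> (\<forall>U\<in>Us. p \<in> U \<longrightarrow> B \<subseteq> U)" if "p \<in> K" for p
    proof -
      have "openin X (\<Inter>{U\<in>Us. p \<in> U})"
        using Us K(3) that by (intro openin_Inter) auto
      moreover have "p \<in> \<Inter>{U\<in>Us. p \<in> U}" by blast
      ultimately obtain C where "C \<in> \<B>" "p \<in> C" "C \<subseteq> \<Inter>{U\<in>Us. p \<in> U}"
        by (rule is_baseE[OF base])
      then show ?thesis by (intro exI[of _ C]) auto
    qed
    then obtain B where B: "\<And>p. p \<in> K \<Longrightarrow> B p \<in> \<B>" "\<And>p. p \<in> K \<Longrightarrow> p \<in> B p"
      "\<And>p U. p \<in> K \<Longrightarrow> U \<in> Us \<Longrightarrow> p \<in> U \<Longrightarrow> B p \<subseteq> U"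
      by metis
    obtain F where F: "finite F" "F \<subseteq> B ` K" "K \<subseteq> \<Union>F"
    proof (rule compactin_base_subcover[OF K(1) base])
      show "B ` K \<subseteq> \<B>" "K \<subseteq> \<Union>(B ` K)" using B(1,2) by auto
    qed
    have "\<forall>U\<in>Us. \<exists>p. p \<in> K \<inter> U" using K(4) by blast
    then obtain q where q: "\<And>U. U \<in> Us \<Longrightarrow> q U \<in> K \<inter> U" by metis
    \<comment> \<open>The subcover \<open>F\<close> handles the inclusion in
      \<open>\<Union>Us\<close>; the added sets \<open>B (q U) \<subseteq> U\<close> force every
      \<open>U\<close> to be met.\<close>
    define G where "G = F \<union> (\<lambda>U. B (q U)) ` Us"
    have GB: "G \<subseteq> B ` K" using F(2) q by (auto simp: G_def)
    have "finite G" "G \<noteq> {}" using F(1) Us(1,2) by (simp_all add: G_def)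
    moreover have "G \<subseteq> \<B>" using GB B(1) by blast
    ultimately have "vietoris_basic X G \<in> \<C>" by (auto simp: \<C>_def)
    moreover have "K \<in> vietoris_basic X G"
    proof -
      have "K \<inter> C \<noteq> {}" if "C \<in> G" for C using that GB B(2) by blast
      moreover have "K \<subseteq> \<Union>G" using F(3) by (auto simp only: G_def)
      ultimately show ?thesis using K(1,2) by (simp add: vietoris_basic_def)
    qed
    moreover have "vietoris_basic X G \<subseteq> vietoris_basic X Us"
    proof
      fix L assume "L \<in> vietoris_basic X G"
      then have L: "compactin X L" "L \<noteq> {}" "L \<subseteq> \<Union>G" "\<And>C. C \<in> G \<Longrightarrow> L \<inter> C \<noteq> {}"
        by (auto simp only: vietoris_basic_def mem_Collect_eq)
      have "\<exists>U\<in>Us. C \<subseteq> U" if CG: "C \<in> G" for C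
      proof -
        obtain p where "p \<in> K" "C = B p" using CG GB by blast
        moreover then obtain U where "U \<in> Us" "p \<in> U" using K(3) by blast
        ultimately show ?thesis using B(3) by metis
      qed
      then have "L \<subseteq> \<Union>Us" using L(3) by blast
      moreover have "L \<inter> U \<noteq> {}" if "U \<in> Us" for U
      proof -
        have "B (q U) \<in> G" using that by (simp add: G_def)
        then have "L \<inter> B (q U) \<noteq> {}" by (rule L(4))
        moreover have "B (q U) \<subseteq> U" using q[OF that] B(3) that by blast
        ultimately show ?thesis by blast
      qed
      ultimately show "L \<in> vietoris_basic X Us"
        using L(1,2) by (simp add: vietoris_basic_def)
    qed
    ultimately show "\<exists>C\<in>\<C>. K \<in> C \<and> C \<subseteq> W" using Us(5) by blast
  qed
  moreover have "point_countable (vietoris X) \<C>"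
    unfolding point_countable_def
  proof
    fix K assume "K \<in> topspace (vietoris X)"
    then have "compactin X K" by (simp add: topspace_vietoris)
    with point_countable_imp_compact_countable_base[OF T1 base pc]
    have "countable {B\<in>\<B>. B \<inter> K \<noteq> {}}"
      unfolding compact_countable_def by blast
    then have "countable (vietoris_basic X ` {F. finite F \<and> F \<subseteq> {B\<in>\<B>. B \<inter> K \<noteq> {}}})"
      by (intro countable_image countable_Collect_finite_subset)
    moreover have "{C\<in>\<C>. K \<in> C} \<subseteq> vietoris_basic X ` {F. finite F \<and> F \<subseteq> {B\<in>\<B>. B \<inter> K \<noteq> {}}}"
    proof
      fix C assume "C \<in> {C\<in>\<C>. K \<in> C}"
      then obtain F where F: "finite F" "F \<subseteq> \<B>" "K \<in> vietoris_basic X F" "C = vietoris_basic X F"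
        by (auto simp: \<C>_def)
      then have "F \<subseteq> {B\<in>\<B>. B \<inter> K \<noteq> {}}" by (auto simp: vietoris_basic_def)
      with F show "C \<in> vietoris_basic X ` {F. finite F \<and> F \<subseteq> {B\<in>\<B>. B \<inter> K \<noteq> {}}}"
        by simp
    qed
    ultimately show "countable {C\<in>\<C>. K \<in> C}" by (rule countable_subset[rotated])
  qed
  ultimately show ?thesis by blast
qed

section \<open>The space of at most two-element subsets\<close>

text \<open>By \<open>near\<close>, \<open>{x}\<close> lies in the closure of \<open>D\<close>,
  since each neighbourhood of \<open>{x}\<close> contains all members of \<open>D\<close> inside
  some neighbourhood of \<open>x\<close>. The conclusion restates convergence to \<open>{x}\<close>
  in terms of \<open>X\<close> alone.\<close>

lemma F2_convergent_sequence:
  assumes FU: "Frechet_Urysohn (F2 X)" and x: "x \<in> topspace X"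
    and D: "\<And>K. K \<in> D \<Longrightarrow> finite K \<and> card K \<le> 2 \<and> K \<noteq> {} \<and> K \<subseteq> topspace X"
    and near: "\<And>N. openin X N \<Longrightarrow> x \<in> N \<Longrightarrow> \<exists>K\<in>D. K \<subseteq> N"
  obtains f :: "nat \<Rightarrow> 'a set" where "\<And>n. f n \<in> D"
    "\<And>N. openin X N \<Longrightarrow> x \<in> N \<Longrightarrow> \<forall>\<^sub>F n in sequentially. f n \<subseteq> N"
proof -
  have cpt: "compactin X K" if "K \<in> D" for K
    using D[OF that] by (simp add: finite_imp_compactin)
  have DF: "D \<subseteq> topspace (F2 X)"
    using D cpt by (auto simp: F2_def topspace_vietoris)
  have "{x} \<in> F2 X closure_of D"
    unfolding in_closure_of
  proof (intro conjI allI impI)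
    show "{x} \<in> topspace (F2 X)" using x by (auto simp: F2_def topspace_vietoris)
    fix W assume "{x} \<in> W \<and> openin (F2 X) W"
    then obtain W' where W': "openin (vietoris X) W'" "W = W' \<inter> {K. finite K \<and> card K \<le> 2}" "{x} \<in> W'"
      by (auto simp: F2_def openin_subtopology)
    obtain N where N: "openin X N" "x \<in> N"
      "\<And>K. compactin X K \<Longrightarrow> K \<noteq> {} \<Longrightarrow> K \<subseteq> N \<Longrightarrow> K \<in> W'"
      using vietoris_nbhd_singleton[OF W'(1,3)] by metis
    obtain K where K: "K \<in> D" "K \<subseteq> N" using near[OF N(1,2)] by blast
    then have "K \<in> W" using N(3) cpt D W'(2) by auto
    with K show "\<exists>K. K \<in> D \<and> K \<in> W" by blast
  qed
  then obtain f :: "nat \<Rightarrow> 'a set" where f: "\<And>n. f n \<in> D" "limitin (F2 X) f {x} sequentially"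
    using Frechet_UrysohnE[OF FU DF] by blast
  then have "limitin (vietoris X) f {x} sequentially"
    by (simp add: F2_def limitin_subtopology)
  then show ?thesis
    using that f(1) eventually_subset_if_limitin_vietoris by (metis empty_subsetI insert_subset)
qed

lemma Frechet_Urysohn_of_F2:
  assumes FU: "Frechet_Urysohn (F2 X)"
  shows "Frechet_Urysohn X"
  unfolding Frechet_Urysohn_def
proof (intro allI impI, elim conjE)
  fix A x assume A: "A \<subseteq> topspace X" "x \<in> X closure_of A"
  then have x: "x \<in> topspace X" by (simp add: in_closure_of)
  let ?D = "(\<lambda>a. {a}) ` A"
  obtain f :: "nat \<Rightarrow> 'a set" where f: "\<And>n. f n \<in> ?D"
    "\<And>N. openin X N \<Longrightarrow> x \<in> N \<Longrightarrow> \<forall>\<^sub>F n in sequentially. f n \<subseteq> N"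
  proof (rule F2_convergent_sequence[OF FU x])
    show "finite K \<and> card K \<le> 2 \<and> K \<noteq> {} \<and> K \<subseteq> topspace X" if "K \<in> ?D" for K
      using that A(1) by auto
    show "\<exists>K\<in>?D. K \<subseteq> N" if "openin X N" "x \<in> N" for N
      using that A(2) by (auto simp: in_closure_of)
  qed blast
  from f(1) have "\<forall>n. \<exists>a. a \<in> A \<and> f n = {a}" by blast
  then obtain a where a: "\<And>n. a n \<in> A" "\<And>n. f n = {a n}" by metis
  with f(2) x have "limitin X a x sequentially" by (simp add: limitin_def)
  with a(1) show "\<exists>f. range f \<subseteq> A \<and> limitin X f x sequentially" by blast
qed

text \<open>If \<open>z\<close> is a nontrivial sequence converging to \<open>x\<close>, pairing the points of \<open>A n\<close> with
  \<open>z n\<close> forces any sequence of such pairs converging to \<open>{x}\<close> to use unboundedly large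
  indices \<open>n\<close>.\<close>

lemma strongly_Frechet_of_F2:
  assumes T1: "t1_space X" and FU: "Frechet_Urysohn (F2 X)"
  shows "strongly_Frechet X"
  unfolding strongly_Frechet_def
proof (intro allI impI, elim conjE)
  fix A :: "nat \<Rightarrow> 'a set" and x
  assume "\<forall>n. A n \<subseteq> topspace X \<and> x \<in> X closure_of A n" and dec: "decseq A"
  then have A: "\<And>n. A n \<subseteq> topspace X" "\<And>n. x \<in> X closure_of A n" by auto
  have x: "x \<in> topspace X" using A(2)[of 0] by (simp add: in_closure_of)
  show "\<exists>f. (\<forall>n. f n \<in> A n) \<and> limitin X f x sequentially"
  \<comment> \<open>If \<open>x\<close> lies in every \<open>A n\<close>, a constant sequence works.
    Otherwise some \<open>A n0\<close> omits \<open>x\<close>, which makes the sequence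
    \<open>z\<close> taken from it nontrivial.\<close>
  proof (cases "\<forall>n. x \<in> A n")
    case True
    then show ?thesis using x by (intro exI[of _ "\<lambda>_. x"]) auto
  next
    case False
    then obtain n0 where n0: "x \<notin> A n0" by blast
    obtain z :: "nat \<Rightarrow> 'a" where z: "\<And>n. z n \<in> A n0" "limitin X z x sequentially"
      using Frechet_UrysohnE[OF Frechet_Urysohn_of_F2[OF FU] A(1)[of n0] A(2)[of n0]] by blast
    have zX: "z n \<in> topspace X" "z n \<noteq> x" for n
      using z(1)[of n] A(1)[of n0] n0 by auto
    define D where "D = {{z n, a} | n a. a \<in> A n}"
    obtain f :: "nat \<Rightarrow> 'a set" where f: "\<And>n. f n \<in> D"
      "\<And>N. openin X N \<Longrightarrow> x \<in> N \<Longrightarrow> \<forall>\<^sub>F n in sequentially. f n \<subseteq> N"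
    proof (rule F2_convergent_sequence[OF FU x])
      show "finite K \<and> card K \<le> 2 \<and> K \<noteq> {} \<and> K \<subseteq> topspace X" if "K \<in> D" for K
      proof -
        obtain n a where K: "K = {z n, a}" "a \<in> A n" using \<open>K \<in> D\<close> by (auto simp: D_def)
        then show ?thesis using A(1)[of n] zX(1)[of n] by (auto simp: card_insert_if)
      qed
      show "\<exists>K\<in>D. K \<subseteq> N" if N: "openin X N" "x \<in> N" for N
      proof -
        obtain n where "z n \<in> N"
          using limitinD[OF z(2) N] by (auto simp: eventually_sequentially)
        moreover obtain a where "a \<in> A n" "a \<in> N"
          using A(2)[of n] N unfolding in_closure_of by blast
        ultimately have "{z n, a} \<in> D" "{z n, a} \<subseteq> N" by (auto simp: D_def)
        then show ?thesis by blast
      qed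
    qed blast
    from f(1) have "\<forall>k. \<exists>m a. a \<in> A m \<and> f k = {z m, a}" unfolding D_def by blast
    then obtain m a where ma: "\<And>k. a k \<in> A (m k)" "\<And>k. f k = {z (m k), a k}" by metis
    \<comment> \<open>By T1 the finite set of the first points of \<open>z\<close> is closed and
      misses \<open>x\<close>, so late sets \<open>f k\<close> avoid it. Since
      \<open>z (m k) \<in> f k\<close>, the index \<open>m k\<close> then exceeds
      \<open>n\<close>.\<close>
    have "\<exists>k\<ge>n. n \<le> m k" for n
    proof -
      have "openin X (topspace X - z ` {..n})"
        using T1 zX(1) by (intro openin_diff) (auto simp: t1_space_closedin_finite)
      moreover have "x \<in> topspace X - z ` {..n}" using x zX(2) by auto
      ultimately have "\<forall>\<^sub>F k in sequentially. f k \<subseteq> topspace X - z ` {..n}" by (rule f(2))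
      then obtain N where "\<And>k. k \<ge> N \<Longrightarrow> f k \<subseteq> topspace X - z ` {..n}"
        by (auto simp: eventually_sequentially)
      then have "f (max n N) \<subseteq> topspace X - z ` {..n}" by simp
      then have "\<not> m (max n N) \<le> n" by (auto simp: ma(2))
      then show ?thesis by (intro exI[of _ "max n N"]) auto
    qed
    then obtain \<kappa> where \<kappa>: "\<And>n. n \<le> \<kappa> n" "\<And>n. n \<le> m (\<kappa> n)" by metis
    have "a (\<kappa> n) \<in> A n" for n
      using ma(1)[of "\<kappa> n"] decseqD[OF dec \<kappa>(2)[of n]] by blast
    moreover have "limitin X (\<lambda>n. a (\<kappa> n)) x sequentially"
      unfolding limitin_sequentially
    proof (intro conjI allI impI, rule x, elim conjE)
      fix U assume "openin X U" "x \<in> U"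
      then obtain N where "\<And>k. k \<ge> N \<Longrightarrow> f k \<subseteq> U"
        using f(2)[of U] by (auto simp: eventually_sequentially)
      then have "\<forall>n\<ge>N. a (\<kappa> n) \<in> U"
        using ma(2) \<kappa>(1) by (metis insert_subset le_trans)
      then show "\<exists>N. \<forall>n\<ge>N. a (\<kappa> n) \<in> U" by blast
    qed
    ultimately show ?thesis by (intro exI[of _ "\<lambda>n. a (\<kappa> n)"]) simp
  qed
qed

text \<open>The k-network is pulled back along the continuous map \<open>\<lambda>x. {x}\<close>,
  and \<open>U\<close> corresponds to the sets contained in \<open>U\<close>.\<close>

lemma point_countable_k_network_of_F2:
  assumes kn: "k_network (F2 X) \<P>" and pc: "point_countable (F2 X) \<P>"
  shows "\<exists>\<Q>. k_network X \<Q> \<and> point_countable X \<Q>"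
proof -
  define q where "q P = {x \<in> topspace X. {x} \<in> P}" for P
  have cont: "continuous_map X (F2 X) (\<lambda>x. {x})"
    unfolding F2_def by (simp add: continuous_map_in_subtopology continuous_map_singleton image_subset_iff)
  have "k_network X (q ` \<P>)"
    unfolding k_network_def
  proof (intro conjI allI impI ballI)
    show "Q \<subseteq> topspace X" if "Q \<in> q ` \<P>" for Q using that by (auto simp: q_def)
    fix K U assume KU: "compactin X K \<and> openin X U \<and> K \<subseteq> U"
    let ?U = "vietoris_basic X {U} \<inter> {K. finite K \<and> card K \<le> 2}"
    have "openin (F2 X) ?U"
      unfolding F2_def openin_subtopology
      using KU openin_vietoris_basic[of "{U}" X] by auto
    moreover have "compactin (F2 X) ((\<lambda>x. {x}) ` K)"
      using image_compactin[OF _ cont] KU by blast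
    moreover have "(\<lambda>x. {x}) ` K \<subseteq> ?U"
      using KU compactin_subset_topspace[of X K] by (auto simp: vietoris_basic_def)
    ultimately obtain F where F: "finite F" "F \<subseteq> \<P>" "(\<lambda>x. {x}) ` K \<subseteq> \<Union>F" "\<Union>F \<subseteq> ?U"
      using kn unfolding k_network_def by meson
    show "\<exists>\<P>'. finite \<P>' \<and> \<P>' \<subseteq> q ` \<P> \<and> K \<subseteq> \<Union>\<P>' \<and> \<Union>\<P>' \<subseteq> U"
    proof (intro exI conjI)
      show "finite (q ` F)" "q ` F \<subseteq> q ` \<P>" using F by auto
      show "K \<subseteq> \<Union>(q ` F)"
        using F(3) KU compactin_subset_topspace[of X K] unfolding q_def by blast
      show "\<Union>(q ` F) \<subseteq> U"
        using F(4) unfolding q_def vietoris_basic_def by blast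
    qed
  qed
  moreover have "point_countable X (q ` \<P>)"
    unfolding point_countable_def
  proof
    fix x assume "x \<in> topspace X"
    then have "{x} \<in> topspace (F2 X)" using cont by (auto simp: continuous_map)
    then have "countable (q ` {P\<in>\<P>. {x} \<in> P})"
      using pc by (simp add: point_countable_def)
    moreover have "{Q\<in>q ` \<P>. x \<in> Q} \<subseteq> q ` {P\<in>\<P>. {x} \<in> P}" unfolding q_def by blast
    ultimately show "countable {Q\<in>q ` \<P>. x \<in> Q}" by (rule countable_subset[rotated])
  qed
  ultimately show ?thesis by blast
qed

section \<open>Weak bases\<close>

lemma weak_base_subset: "weak_base X \<P> \<Longrightarrow> y \<in> topspace X \<Longrightarrow> P \<in> \<P> y \<Longrightarrow> P \<subseteq> topspace X \<and> y \<in> P"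
  by (simp add: weak_base_def)

lemma weak_base_Int:
  "weak_base X \<P> \<Longrightarrow> y \<in> topspace X \<Longrightarrow> U \<in> \<P> y \<Longrightarrow> V \<in> \<P> y \<Longrightarrow> \<exists>W\<in>\<P> y. W \<subseteq> U \<inter> V"
  by (simp add: weak_base_def)

lemma weak_base_nbhd:
  "weak_base X \<P> \<Longrightarrow> openin X U \<Longrightarrow> y \<in> U \<Longrightarrow> \<exists>P\<in>\<P> y. P \<subseteq> U"
  unfolding weak_base_def by (meson openin_subset subsetD)

lemma weak_base_openin:
  assumes "weak_base X \<P>" "G \<subseteq> topspace X" "\<And>y. y \<in> G \<Longrightarrow> \<exists>P\<in>\<P> y. P \<subseteq> G"
  shows "openin X G"
proof -
  have "\<forall>G. G \<subseteq> topspace X \<and> (\<forall>y\<in>G. \<exists>P\<in>\<P> y. P \<subseteq> G) \<longrightarrow> openin X G"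
    using assms(1) unfolding weak_base_def by (elim conjE)
  then have "G \<subseteq> topspace X \<and> (\<forall>y\<in>G. \<exists>P\<in>\<P> y. P \<subseteq> G) \<longrightarrow> openin X G" ..
  with assms(2,3) show ?thesis by blast
qed

text \<open>Let \<open>C\<close> be the set of terms outside \<open>P\<close>. Adding
  \<open>y\<close> makes \<open>C\<close> compact, hence closed, so the complement of
  \<open>C\<close> contains a weak base member at each of its points other than \<open>y\<close>; at
  \<open>y\<close> it contains \<open>P\<close>. Hence it is open and contains almost all
  terms.\<close>

lemma weak_base_eventually:
  assumes haus: "Hausdorff_space X" and wb: "weak_base X \<P>"
    and s: "limitin X s y sequentially" and P: "P \<in> \<P> y"
  shows "\<forall>\<^sub>F n in sequentially. s n \<in> P"
proof -
  have y: "y \<in> topspace X" using s by (rule limitin_topspace)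
  have PX: "P \<subseteq> topspace X" "y \<in> P" using weak_base_subset[OF wb y P] by auto
  define C where "C = (range s - P) \<inter> topspace X"
  have "compactin X (insert y C)"
    using s by (rule compactin_sequence_with_limit) (auto simp: C_def)
  then have "closedin X (insert y C)"
    using haus by (simp add: compactin_imp_closedin)
  then have op: "openin X (topspace X - insert y C)" by blast
  have "openin X (topspace X - C)"
  proof (rule weak_base_openin[OF wb])
    fix p assume p: "p \<in> topspace X - C"
    show "\<exists>Q\<in>\<P> p. Q \<subseteq> topspace X - C"
    proof (cases "p = y")
      case True
      then show ?thesis using P PX by (auto simp: C_def)
    next
      case False
      then show ?thesis using weak_base_nbhd[OF wb op, of p] p by blast
    qed
  qed blast
  moreover have "y \<in> topspace X - C" using y PX by (simp add: C_def)
  ultimately have "\<forall>\<^sub>F n in sequentially. s n \<in> topspace X - C"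
    using limitinD[OF s] by blast
  then show ?thesis by (rule eventually_mono) (auto simp: C_def)
qed

lemma weak_base_countable_decseq:
  assumes wb: "weak_base X \<P>" and y: "y \<in> topspace X" and ctb: "countable (\<P> y)"
  obtains Q :: "nat \<Rightarrow> 'a set" where "\<And>n. Q n \<in> \<P> y" "decseq Q"
    "\<And>U. openin X U \<Longrightarrow> y \<in> U \<Longrightarrow> \<exists>n. Q n \<subseteq> U"
proof -
  have ne: "\<P> y \<noteq> {}" using weak_base_nbhd[OF wb openin_topspace y] by blast
  define e where "e = from_nat_into (\<P> y)"
  have e: "range e = \<P> y" unfolding e_def using ne ctb by (rule range_from_nat_into)
  have "\<exists>Q. Q 0 \<in> \<P> y \<and> (\<forall>n. Q (Suc n) \<in> \<P> y \<and> Q (Suc n) \<subseteq> Q n \<inter> e n)"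
  proof -
    have "\<exists>Q. \<forall>n. Q n \<in> \<P> y \<and> Q (Suc n) \<subseteq> Q n \<inter> e n"
    proof (rule dependent_nat_choice)
      show "\<exists>x. x \<in> \<P> y" using ne by blast
      show "\<exists>z. z \<in> \<P> y \<and> z \<subseteq> x \<inter> e n" if "x \<in> \<P> y" for x n
        using weak_base_Int[OF wb y that, of "e n"] e by blast
    qed
    then show ?thesis by blast
  qed
  then obtain Q where Q: "Q 0 \<in> \<P> y" "\<And>n. Q (Suc n) \<in> \<P> y" "\<And>n. Q (Suc n) \<subseteq> Q n \<inter> e n"
    by blast
  show ?thesis
  proof
    show "Q n \<in> \<P> y" for n using Q(1,2) by (cases n) auto
    show "decseq Q" using Q(3) by (intro decseq_SucI) blast
    fix U assume "openin X U" "y \<in> U"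
    then obtain P where "P \<in> \<P> y" "P \<subseteq> U" using weak_base_nbhd[OF wb] by blast
    moreover then obtain n where "P = e n" using e by blast
    ultimately show "\<exists>n. Q n \<subseteq> U" using Q(3)[of n] by blast
  qed
qed

lemma countable_weak_base_at:
  assumes wb: "weak_base X \<P>" and pc: "point_countable X (weak_base_family X \<P>)"
    and y: "y \<in> topspace X"
  shows "countable (\<P> y)"
proof -
  have "\<P> y \<subseteq> {P\<in>weak_base_family X \<P>. y \<in> P}"
    using weak_base_subset[OF wb y] y by (auto simp: weak_base_family_def)
  then show ?thesis
    using pc y countable_subset by (fastforce simp: point_countable_def)
qed

text \<open>In a Hausdorff space the singletons form a closed part of the hyperspace, and weak bases
  restrict to closed subspaces.\<close>

lemma weak_base_of_singletons:
  assumes haus: "Hausdorff_space X" and wb: "weak_base (vietoris X) \<W>"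
  shows "weak_base X (\<lambda>x. (\<lambda>W. {p. {p} \<in> W}) ` \<W> {x})"
proof -
  have sing: "{x} \<in> topspace (vietoris X) \<longleftrightarrow> x \<in> topspace X" for x
    by (simp add: topspace_vietoris)
  have top: "W \<subseteq> topspace (vietoris X) \<and> {x} \<in> W" if "x \<in> topspace X" "W \<in> \<W> {x}" for x W
    using weak_base_subset[OF wb] that sing by blast
  show ?thesis
    unfolding weak_base_def
  proof (intro conjI ballI allI impI)
    fix y P assume "y \<in> topspace X" "P \<in> (\<lambda>W. {p. {p} \<in> W}) ` \<W> {y}"
    then show "P \<subseteq> topspace X" "y \<in> P" using top sing by blast+
  next
    fix y U V assume y: "y \<in> topspace X" and "U \<in> (\<lambda>W. {p. {p} \<in> W}) ` \<W> {y}" "V \<in> (\<lambda>W. {p. {p} \<in> W}) ` \<W> {y}"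
    then obtain U' V' where U': "U' \<in> \<W> {y}" "U = {p. {p} \<in> U'}" and V': "V' \<in> \<W> {y}" "V = {p. {p} \<in> V'}"
      by blast
    then obtain W where "W \<in> \<W> {y}" "W \<subseteq> U' \<inter> V'"
      using weak_base_Int[OF wb, of "{y}"] sing y by blast
    then show "\<exists>W\<in>(\<lambda>W. {p. {p} \<in> W}) ` \<W> {y}. W \<subseteq> U \<inter> V"
      using U' V' by (intro bexI[of _ "{p. {p} \<in> W}"]) auto
  next
    fix y U assume U: "openin X U \<and> y \<in> U"
    then have "openin (vietoris X) (vietoris_basic X {U})" by (intro openin_vietoris_basic) auto
    moreover have "{y} \<in> vietoris_basic X {U}"
      using U openin_subset[of X U] by (auto simp: vietoris_basic_def)
    ultimately obtain W where W: "W \<in> \<W> {y}" "W \<subseteq> vietoris_basic X {U}"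
      using weak_base_nbhd[OF wb] by blast
    then have "{p. {p} \<in> W} \<subseteq> U" by (auto simp: vietoris_basic_def)
    with W(1) show "\<exists>P\<in>(\<lambda>W. {p. {p} \<in> W}) ` \<W> {y}. P \<subseteq> U" by blast
  next
    fix G assume "G \<subseteq> topspace X \<and> (\<forall>y\<in>G. \<exists>P\<in>(\<lambda>W. {p. {p} \<in> W}) ` \<W> {y}. P \<subseteq> G)"
    then have G: "G \<subseteq> topspace X" "\<And>y. y \<in> G \<Longrightarrow> \<exists>W\<in>\<W> {y}. {p. {p} \<in> W} \<subseteq> G" by blast+
    \<comment> \<open>\<open>H\<close> omits only the singletons outside \<open>G\<close>. At
      non-singletons the open set \<open>nonsing\<close> lies in it; at \<open>{y}\<close> with
      \<open>y \<in> G\<close> the given weak base member does. So \<open>H\<close> is open, and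
      \<open>G\<close> is its preimage.\<close>
    define H where "H = topspace (vietoris X) - (\<lambda>p. {p}) ` (topspace X - G)"
    define nonsing where "nonsing = {K \<in> topspace (vietoris X). \<nexists>p. K = {p}}"
    have nonsing: "openin (vietoris X) nonsing"
    proof (subst openin_subopen, intro ballI)
      fix K assume "K \<in> nonsing"
      then have K: "compactin X K" "K \<noteq> {}" "\<nexists>p. K = {p}"
        by (auto simp: nonsing_def topspace_vietoris)
      then obtain p q where pq: "p \<in> K" "q \<in> K" "p \<noteq> q" by blast
      moreover have "K \<subseteq> topspace X" using K(1) by (rule compactin_subset_topspace)
      ultimately obtain U V where UV: "openin X U" "openin X V" "p \<in> U" "q \<in> V" "disjnt U V"
        using haus unfolding Hausdorff_space_def by (meson subsetD)
      have "openin (vietoris X) (vietoris_basic X {topspace X, U, V})"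
        using UV by (intro openin_vietoris_basic) auto
      moreover have "K \<in> vietoris_basic X {topspace X, U, V}"
        using K pq UV \<open>K \<subseteq> topspace X\<close> by (auto simp: vietoris_basic_def)
      moreover have "vietoris_basic X {topspace X, U, V} \<subseteq> nonsing"
        using UV(5) by (auto simp: vietoris_basic_def nonsing_def topspace_vietoris disjnt_def)
      ultimately show "\<exists>T. openin (vietoris X) T \<and> K \<in> T \<and> T \<subseteq> nonsing" by blast
    qed
    have "openin (vietoris X) H"
    proof (rule weak_base_openin[OF wb])
      show "H \<subseteq> topspace (vietoris X)" by (auto simp: H_def)
      fix K assume K: "K \<in> H"
      show "\<exists>W\<in>\<W> K. W \<subseteq> H"
      proof (cases "\<exists>p. K = {p}")
        case True
        then obtain y where y: "K = {y}" by blast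
        with K have "y \<in> G" by (auto simp: H_def topspace_vietoris)
        then obtain W where W: "W \<in> \<W> {y}" "{p. {p} \<in> W} \<subseteq> G" using G(2) by blast
        moreover have "W \<subseteq> topspace (vietoris X)" using top W(1) G(1) \<open>y \<in> G\<close> by blast
        ultimately have "W \<subseteq> H" by (auto simp: H_def)
        with W y show ?thesis by blast
      next
        case False
        then have "K \<in> nonsing" using K by (auto simp: nonsing_def H_def)
        moreover have "nonsing \<subseteq> H" by (auto simp: nonsing_def H_def)
        moreover obtain W where "W \<in> \<W> K" "W \<subseteq> nonsing"
          using weak_base_nbhd[OF wb nonsing \<open>K \<in> nonsing\<close>] by (rule bexE)
        ultimately show ?thesis by (intro bexI[of _ W]) simp_all
      qed
    qed
    then have "openin X {x \<in> topspace X. {x} \<in> H}"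
      by (rule openin_continuous_map_preimage[OF continuous_map_singleton])
    moreover have "{x \<in> topspace X. {x} \<in> H} = G"
      using G(1) sing unfolding H_def by auto
    ultimately show "openin X G" by simp
  qed
qed

section \<open>Sequential closure and the passage from weak bases to bases\<close>

text \<open>Limits are taken only once. In general the operator need not be idempotent, and its
  idempotence is what the fan argument establishes.\<close>

definition seq_closure :: "'a topology \<Rightarrow> 'a set \<Rightarrow> 'a set" where
  "seq_closure X A = {y. \<exists>s::nat \<Rightarrow> 'a. range s \<subseteq> A \<and> limitin X s y sequentially}"

text \<open>If \<open>T\<close> consists of \<open>y\<close> and a sequence \<open>u\<close> converging to \<open>y\<close>, and each \<open>u n\<close> is the limit of
  \<open>v n m\<close> in \<open>A\<close> as \<open>m\<close> tends to infinity, then the sets \<open>insert (v n m) T\<close> form a sequential fan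
  with vertex \<open>T\<close> in the hyperspace. A countable weak base at \<open>T\<close> picks a diagonal sequence
  from this fan that converges to \<open>T\<close>; its points are kept away from every \<open>u k\<close>, so they
  converge to \<open>y\<close>.\<close>

lemma seq_closure_idem:
  assumes haus: "Hausdorff_space X" and wb: "weak_base (vietoris X) \<W>"
    and ctb: "\<And>T. T \<in> topspace (vietoris X) \<Longrightarrow> countable (\<W> T)"
    and A: "A \<subseteq> topspace X"
  shows "seq_closure X (seq_closure X A) \<subseteq> seq_closure X A"
proof
  fix y assume "y \<in> seq_closure X (seq_closure X A)"
  then obtain u :: "nat \<Rightarrow> 'a" where u: "\<And>n. u n \<in> seq_closure X A" "limitin X u y sequentially"
    unfolding seq_closure_def by blast
  then have "\<forall>n. \<exists>s::nat \<Rightarrow> 'a. range s \<subseteq> A \<and> limitin X s (u n) sequentially"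
    unfolding seq_closure_def by blast
  then obtain v :: "nat \<Rightarrow> nat \<Rightarrow> 'a" where v: "\<And>n m. v n m \<in> A" "\<And>n. limitin X (v n) (u n) sequentially"
    by (metis range_subsetD)
  have y: "y \<in> topspace X" using u(2) by (rule limitin_topspace)
  have uX: "u n \<in> topspace X" for n using v(2) by (rule limitin_topspace)
  show "y \<in> seq_closure X A"
  proof (cases "y \<in> range u")
    case True
    then show ?thesis using u(1) by blast
  next
    case False
    define T where "T = insert y (range u)"
    have T: "compactin X T"
      unfolding T_def using u(2) uX by (intro compactin_sequence_with_limit) auto
    then have Ttop: "T \<in> topspace (vietoris X)" by (auto simp: topspace_vietoris T_def)
    have "\<exists>U V. openin X U \<and> openin X V \<and> u k \<in> U \<and> T - {u k} \<subseteq> V \<and> disjnt U V" for k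
    proof -
      have "compactin X (insert y (range u - {u k}))"
        using u(2) uX by (intro compactin_sequence_with_limit) auto
      moreover have "insert y (range u - {u k}) = T - {u k}" using False by (auto simp: T_def)
      ultimately have "compactin X (T - {u k})" by simp
      moreover have "compactin X {u k}" "disjnt {u k} (T - {u k})" using uX by auto
      ultimately obtain U V where "openin X U" "openin X V" "{u k} \<subseteq> U" "T - {u k} \<subseteq> V" "disjnt U V"
        using haus unfolding Hausdorff_space_compact_sets by metis
      then show ?thesis by blast
    qed
    then obtain U V where UV: "\<And>k. openin X (U k)" "\<And>k. openin X (V k)" "\<And>k. u k \<in> U k"
      "\<And>k. T - {u k} \<subseteq> V k" "\<And>k. disjnt (U k) (V k)"
      by metis
    obtain Q :: "nat \<Rightarrow> 'a set set" where Q: "\<And>n. Q n \<in> \<W> T" "decseq Q"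
      "\<And>E. openin (vietoris X) E \<Longrightarrow> T \<in> E \<Longrightarrow> \<exists>n. Q n \<subseteq> E"
      using weak_base_countable_decseq[OF wb Ttop ctb[OF Ttop]] by metis
    \<comment> \<open>The sequence \<open>u\<close> may repeat values. The condition
      \<open>u k \<noteq> u n\<close> puts \<open>u n\<close> into \<open>V k\<close>, so that
      \<open>v n m\<close> lies there for all large \<open>m\<close>.\<close>
    have "\<exists>m. insert (v n m) T \<in> Q n \<and> (\<forall>k\<in>{k. k < n \<and> u k \<noteq> u n}. v n m \<in> V k)" for n
    proof -
      have "limitin (vietoris X) (\<lambda>m. insert (v n m) T) (insert (u n) T) sequentially"
        using v(2) T by (rule limitin_vietoris_insert)
      moreover have "insert (u n) T = T" by (auto simp: T_def)
      ultimately have "\<forall>\<^sub>F m in sequentially. insert (v n m) T \<in> Q n"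
        using weak_base_eventually[OF Hausdorff_space_vietoris[OF haus] wb _ Q(1)] by simp
      moreover have "\<forall>\<^sub>F m in sequentially. \<forall>k\<in>{k. k < n \<and> u k \<noteq> u n}. v n m \<in> V k"
      proof (intro eventually_ball_finite ballI)
        show "finite {k. k < n \<and> u k \<noteq> u n}" by simp
        fix k assume "k \<in> {k. k < n \<and> u k \<noteq> u n}"
        then have "u n \<in> T - {u k}" by (auto simp: T_def)
        then show "\<forall>\<^sub>F m in sequentially. v n m \<in> V k"
          using UV(4)[of k] by (intro limitinD[OF v(2) UV(2)]) blast
      qed
      ultimately have "\<forall>\<^sub>F m in sequentially. insert (v n m) T \<in> Q n \<and>
          (\<forall>k\<in>{k. k < n \<and> u k \<noteq> u n}. v n m \<in> V k)"
        by (rule eventually_conj)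
      then show ?thesis by (rule eventually_happens'[OF sequentially_bot])
    qed
    then obtain m where m: "\<And>n. insert (v n (m n)) T \<in> Q n"
      "\<And>n k. k < n \<Longrightarrow> u k \<noteq> u n \<Longrightarrow> v n (m n) \<in> V k"
      by (metis (mono_tags, lifting) mem_Collect_eq)
    define z where "z n = v n (m n)" for n
    have "limitin X z y sequentially"
      unfolding limitin_def
    proof (intro conjI allI impI, rule y, elim conjE)
      fix N assume N: "openin X N" "y \<in> N"
      obtain n0 where n0: "\<And>n. n \<ge> n0 \<Longrightarrow> u n \<in> N"
        using limitinD[OF u(2) N] by (auto simp: eventually_sequentially)
      \<comment> \<open>This open set contains \<open>T\<close>, so late \<open>z n\<close> lie in
        it. Since they also lie in \<open>V k\<close> for every \<open>k < n0\<close>, they avoid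
        each such \<open>U k\<close> and must lie in \<open>N\<close>.\<close>
      define E where "E = N \<union> (\<Union>k<n0. U k)"
      have E: "openin X E" using N UV(1) by (auto simp: E_def)
      have TO: "T \<subseteq> E"
      proof -
        have "u n \<in> E" for n
          using n0[of n] UV(3)[of n] by (cases "n \<ge> n0") (auto simp: E_def)
        then show ?thesis using N by (auto simp: T_def E_def)
      qed
      have "openin (vietoris X) (vietoris_basic X {E})" using E by (intro openin_vietoris_basic) auto
      moreover have "T \<in> vietoris_basic X {E}"
        using TO T by (auto simp: vietoris_basic_def T_def)
      ultimately obtain n1 where n1: "Q n1 \<subseteq> vietoris_basic X {E}" using Q(3) by blast
      have zO: "z n \<in> E" if "n \<ge> n1" for n
      proof -
        have "insert (z n) T \<in> vietoris_basic X {E}"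
          using m(1)[of n] decseqD[OF Q(2) that] n1 unfolding z_def by blast
        then show ?thesis by (simp add: vietoris_basic_def)
      qed
      have "\<forall>\<^sub>F n in sequentially. \<forall>k\<in>{..<n0}. u n \<noteq> u k"
      proof (intro eventually_ball_finite ballI)
        fix k
        \<comment> \<open>As \<open>y\<close> differs from \<open>u k\<close>, the sequence
          \<open>u\<close> takes the value \<open>u k\<close> only finitely often.\<close>
        have "openin X (topspace X - {u k})"
          using Hausdorff_imp_t1_space[OF haus] uX
          by (intro openin_diff) (auto simp: closedin_t1_singleton)
        then have "\<forall>\<^sub>F n in sequentially. u n \<in> topspace X - {u k}"
          using y False by (intro limitinD[OF u(2)]) auto
        then show "\<forall>\<^sub>F n in sequentially. u n \<noteq> u k" by (rule eventually_mono) blast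
      qed simp
      then obtain n2 where n2: "\<And>n k. n \<ge> n2 \<Longrightarrow> k < n0 \<Longrightarrow> u n \<noteq> u k"
        by (auto simp: eventually_sequentially)
      have "z n \<in> N" if n: "n \<ge> Max {n0, n1, n2}" for n
      proof -
        have "z n \<notin> U k" if "k < n0" for k
        proof -
          have "k < n" "u k \<noteq> u n" using that n n2[of n k] by auto
          then have "z n \<in> V k" unfolding z_def by (rule m(2))
          with UV(5)[of k] show ?thesis by (auto simp: disjnt_def)
        qed
        moreover have "z n \<in> E" using n by (intro zO) simp
        ultimately show ?thesis by (auto simp: E_def)
      qed
      then show "\<forall>\<^sub>F n in sequentially. z n \<in> N" by (auto simp only: eventually_sequentially)
    qed
    moreover have "range z \<subseteq> A" using v(1) by (auto simp: z_def)
    ultimately show ?thesis unfolding seq_closure_def by blast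
  qed
qed

text \<open>The weak base induced on \<open>X\<close> by the singletons turns out to consist of
  neighbourhoods, so its interiors form a point-countable base.\<close>

lemma point_countable_base_of_vietoris_weak_base:
  assumes haus: "Hausdorff_space X" and wb: "weak_base (vietoris X) \<W>"
    and pc: "point_countable (vietoris X) (weak_base_family (vietoris X) \<W>)"
  shows "\<exists>\<B>. is_base X \<B> \<and> point_countable X \<B>"
proof -
  define q where "q W = {p. {p} \<in> W}" for W :: "'a set set"
  define \<Q> where "\<Q> x = q ` \<W> {x}" for x
  have wbX: "weak_base X \<Q>"
    unfolding \<Q>_def q_def using haus wb by (rule weak_base_of_singletons)
  have pcX: "point_countable X (weak_base_family X \<Q>)"
    unfolding point_countable_def
  proof
    fix x assume "x \<in> topspace X"
    then have "{x} \<in> topspace (vietoris X)" by (simp add: topspace_vietoris)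
    then have "countable (q ` {P\<in>weak_base_family (vietoris X) \<W>. {x} \<in> P})"
      using pc by (simp add: point_countable_def)
    moreover have "{P\<in>weak_base_family X \<Q>. x \<in> P} \<subseteq> q ` {P\<in>weak_base_family (vietoris X) \<W>. {x} \<in> P}"
    proof
      fix P assume "P \<in> {P\<in>weak_base_family X \<Q>. x \<in> P}"
      then obtain y W where "y \<in> topspace X" "W \<in> \<W> {y}" "P = q W" "x \<in> q W"
        by (auto simp: weak_base_family_def \<Q>_def)
      moreover then have "W \<in> weak_base_family (vietoris X) \<W>"
        unfolding weak_base_family_def by (intro UN_I[of "{y}"]) (simp_all add: topspace_vietoris)
      ultimately show "P \<in> q ` {P\<in>weak_base_family (vietoris X) \<W>. {x} \<in> P}"
        by (simp add: q_def)
    qed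
    ultimately show "countable {P\<in>weak_base_family X \<Q>. x \<in> P}" by (rule countable_subset[rotated])
  qed
  have nbhd: "x \<in> X interior_of Q" if x: "x \<in> topspace X" and Q: "Q \<in> \<Q> x" for x Q
  proof -
    define A where "A = topspace X - Q"
    define G where "G = topspace X - seq_closure X A"
    have idem: "seq_closure X (seq_closure X A) \<subseteq> seq_closure X A"
      using haus wb countable_weak_base_at[OF wb pc] by (rule seq_closure_idem) (auto simp: A_def)
    \<comment> \<open>If no weak base member at \<open>y\<close> fits into \<open>G\<close>, points
      of the sequential closure chosen from a decreasing sequence of members converge to
      \<open>y\<close>. Idempotence then puts \<open>y\<close> into the sequential closure.\<close>
    have "openin X G"
    proof (rule weak_base_openin[OF wbX])
      show "G \<subseteq> topspace X" by (auto simp: G_def)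
      fix y assume y: "y \<in> G"
      then have yX: "y \<in> topspace X" by (simp add: G_def)
      obtain P :: "nat \<Rightarrow> 'a set" where P: "\<And>n. P n \<in> \<Q> y" "decseq P"
        "\<And>U. openin X U \<Longrightarrow> y \<in> U \<Longrightarrow> \<exists>n. P n \<subseteq> U"
        using weak_base_countable_decseq[OF wbX yX countable_weak_base_at[OF wbX pcX yX]] by metis
      show "\<exists>P\<in>\<Q> y. P \<subseteq> G"
      proof (rule ccontr)
        assume contra: "\<not> (\<exists>P\<in>\<Q> y. P \<subseteq> G)"
        have "\<exists>a. a \<in> P n \<and> a \<in> seq_closure X A" for n
          using contra P(1)[of n] weak_base_subset[OF wbX yX P(1)[of n]] unfolding G_def by blast
        then obtain s where s: "\<And>n. s n \<in> P n" "\<And>n. s n \<in> seq_closure X A" by metis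
        have "limitin X s y sequentially"
          unfolding limitin_sequentially
        proof (intro conjI allI impI, rule yX, elim conjE)
          fix U assume "openin X U" "y \<in> U"
          then obtain n where "P n \<subseteq> U" using P(3) by blast
          then show "\<exists>N. \<forall>n\<ge>N. s n \<in> U" using s(1) decseqD[OF P(2)] by blast
        qed
        then have "y \<in> seq_closure X (seq_closure X A)"
          using s(2) unfolding seq_closure_def[of X "seq_closure X A"] by blast
        with idem y show False by (auto simp: G_def)
      qed
    qed
    moreover have "x \<in> G"
    proof -
      \<comment> \<open>A sequence converging to \<open>x\<close> is eventually in \<open>Q\<close>,
        so none can stay in the complement \<open>A\<close>.\<close>
      have False if "range s \<subseteq> A" "limitin X s x sequentially" for s :: "nat \<Rightarrow> 'a"
      proof -
        have "\<forall>\<^sub>F n in sequentially. s n \<in> Q"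
          using haus wbX that(2) Q by (rule weak_base_eventually)
        then obtain n where "s n \<in> Q" by (auto simp: eventually_sequentially)
        with that(1) show False by (auto simp: A_def)
      qed
      then show ?thesis using x by (auto simp: G_def seq_closure_def)
    qed
    moreover have "G \<subseteq> Q"
    proof
      fix p assume p: "p \<in> G"
      have "p \<in> seq_closure X A" if "p \<in> A"
        unfolding seq_closure_def using that by (auto intro!: exI[of _ "\<lambda>_. p"] simp: A_def)
      with p show "p \<in> Q" by (auto simp: G_def A_def)
    qed
    ultimately show ?thesis by (auto simp: interior_of_def)
  qed
  have "is_base X ((\<lambda>P. X interior_of P) ` weak_base_family X \<Q>)"
  proof (rule is_baseI)
    fix U x assume U: "openin X U" "x \<in> U"
    then obtain Q where Q: "Q \<in> \<Q> x" "Q \<subseteq> U" using weak_base_nbhd[OF wbX] by blast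
    have x: "x \<in> topspace X" using U openin_subset[of X U] by blast
    have "X interior_of Q \<subseteq> U" using Q(2) interior_of_subset[of X Q] by simp
    moreover have "Q \<in> weak_base_family X \<Q>" using Q(1) x by (auto simp: weak_base_family_def)
    ultimately show "\<exists>B\<in>(\<lambda>P. X interior_of P) ` weak_base_family X \<Q>. x \<in> B \<and> B \<subseteq> U"
      using nbhd[OF x Q(1)] by (intro bexI[of _ "X interior_of Q"]) simp_all
  qed auto
  moreover have "point_countable X ((\<lambda>P. X interior_of P) ` weak_base_family X \<Q>)"
    unfolding point_countable_def
  proof
    fix x assume "x \<in> topspace X"
    then have "countable ((\<lambda>P. X interior_of P) ` {P\<in>weak_base_family X \<Q>. x \<in> P})"
      using pcX by (simp add: point_countable_def)
    moreover have "{B\<in>(\<lambda>P. X interior_of P) ` weak_base_family X \<Q>. x \<in> B} \<subseteq>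
        (\<lambda>P. X interior_of P) ` {P\<in>weak_base_family X \<Q>. x \<in> P}"
      using interior_of_subset[of X] by auto
    ultimately show "countable {B\<in>(\<lambda>P. X interior_of P) ` weak_base_family X \<Q>. x \<in> B}"
      by (rule countable_subset[rotated])
  qed
  ultimately show ?thesis by blast
qed

theorem theorem3p11:
  fixes X :: "'a topology"
  assumes "regular_space X" and "Hausdorff_space X"
  defines "c1 \<equiv> (\<exists>\<B>. is_base X \<B> \<and> point_countable X \<B>)"
      and "c2 \<equiv> Frechet_Urysohn (F2 X) \<and> (\<exists>\<P>. k_network (F2 X) \<P> \<and> point_countable (F2 X) \<P>)"
      and "c3 \<equiv> Frechet_Urysohn (vietoris X) \<and>
                 (\<exists>\<P>. k_network (vietoris X) \<P> \<and> point_countable (vietoris X) \<P>)"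
      and "c4 \<equiv> (\<exists>\<P>. weak_base (vietoris X) \<P> \<and>
                 point_countable (vietoris X) (weak_base_family (vietoris X) \<P>))"
      and "c5 \<equiv> (\<exists>\<P>. weak_base (vietoris X) \<P> \<and>
                 compact_countable (vietoris X) (weak_base_family (vietoris X) \<P>))"
      and "c6 \<equiv> (\<exists>\<B>. is_base (vietoris X) \<B> \<and> point_countable (vietoris X) \<B>)"
  shows "(c1 \<longleftrightarrow> c2) \<and> (c1 \<longleftrightarrow> c3) \<and> (c1 \<longleftrightarrow> c4) \<and> (c1 \<longleftrightarrow> c5) \<and> (c1 \<longleftrightarrow> c6)"
proof -
  have T1: "t1_space X" using assms(2) by (rule Hausdorff_imp_t1_space)
  have T1_vietoris: "t1_space (vietoris X)"
    using Hausdorff_space_vietoris[OF assms(2)] by (rule Hausdorff_imp_t1_space)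
  \<comment> \<open>Two cycles give all equivalences: \<open>c1\<close>, \<open>c6\<close>,
    \<open>c5\<close>, \<open>c4\<close>, \<open>c1\<close> and \<open>c1\<close>,
    \<open>c6\<close>, \<open>c3\<close>, \<open>c2\<close>, \<open>c1\<close>.\<close>
  have "c6" if c1
    using that unfolding c1_def c6_def by (meson point_countable_base_vietoris[OF T1])
  moreover have "c5" if c6
  proof -
    from that obtain \<B> where \<B>: "is_base (vietoris X) \<B>" "point_countable (vietoris X) \<B>"
      unfolding c6_def by blast
    let ?W = "\<lambda>K. {B\<in>\<B>. K \<in> B}"
    have cc: "compact_countable (vietoris X) \<B>"
      using T1_vietoris \<B> by (rule point_countable_imp_compact_countable_base)
    have "compact_countable (vietoris X) (weak_base_family (vietoris X) ?W)"
      unfolding compact_countable_def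
    proof (intro allI impI)
      fix K assume "compactin (vietoris X) K"
      with cc have "countable {P\<in>\<B>. P \<inter> K \<noteq> {}}" by (simp add: compact_countable_def)
      then show "countable {P \<in> weak_base_family (vietoris X) ?W. P \<inter> K \<noteq> {}}"
        by (rule countable_subset[rotated]) (auto simp: weak_base_family_def)
    qed
    then show c5 using base_imp_weak_base[OF \<B>(1)] unfolding c5_def by (intro exI conjI)
  qed
  moreover have "c4" if c5
    using that unfolding c4_def c5_def by (meson compact_countable_imp_point_countable)
  moreover have "c1" if c4
    using that unfolding c1_def c4_def
    by (meson point_countable_base_of_vietoris_weak_base[OF assms(2)])
  moreover have "c3" if c6
    using that unfolding c3_def c6_def
    by (meson point_countable_base_imp_Frechet_Urysohn base_imp_k_network)
  moreover have "c2" if c3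
    using that unfolding c2_def c3_def F2_def
    by (meson Frechet_Urysohn_subtopology k_network_subtopology point_countable_subtopology)
  moreover have "c1" if c2
  proof -
    from that have FU: "Frechet_Urysohn (F2 X)" by (simp add: c2_def)
    from that obtain \<P> where \<P>: "k_network X \<P>" "point_countable X \<P>"
      using point_countable_k_network_of_F2 unfolding c2_def by metis
    have sF: "strongly_Frechet X" using T1 FU by (rule strongly_Frechet_of_F2)
    show c1
      unfolding c1_def
      using assms(1) Frechet_Urysohn_of_F2[OF FU] \<P>(2) interior_covers_of_k_network[OF sF \<P>]
      by (rule point_countable_base_of_interior_covers)
  qed
  ultimately show ?thesis by blast
qed

end
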